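(* Let $k\ge1$, and suppose $\mathbf p_0,\ldots,\mathbf p_k,\mathbf q_1,\mathbf q_2:\mathbb R\to\mathbb C^3$ are differentiable functions satisfying, at $t=0$, $$\omega(\mathbf q_1,\mathbf q_2)=0,\qquad \omega(\mathbf p_k,\mathbf q_2)=0,\qquad j\,\omega(\mathbf p_j,\mathbf q_1)+(j-1)\,\omega(\mathbf p_{j-1},\mathbf q_2)=0\quad\text{for }1\le j\le k,$$ and, for all $t\in\mathbb R$, $$\frac{d\mathbf p_0}{dt}=2\,\mathbf p_1\times\mathbf q_1,\qquad \frac{d\mathbf p_k}{dt}=2k\,\mathbf p_k\times\mathbf q_2,$$ $$\frac{d\mathbf p_j}{dt}=2(j+1)\,\mathbf p_{j+1}\times\mathbf q_1+2j\,\mathbf p_j\times\mathbf q_2\quad\text{for }1\le j\le k-1,$$ $$\frac{d\mathbf q_1}{dt}=-2\,\mathbf q_1\times\mathbf q_2,\qquad \frac{d\mathbf q_2}{dt}=0.$$ Define $$N=\bigl\{\mathbf p_0(t)+x\,\mathbf p_1(t)+\cdots+x^k\,\mathbf p_k(t)+y\,\mathbf q_1(t)+xy\,\mathbf q_2(t):x,y,t\in\mathbb R\bigr\}\subset\mathbb C^3.$$ Then $N$ is a special Lagrangian $3$-fold in $\mathbb C^3$ wherever it is nonsingular.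
   Context: On $\mathbb C^3$ set $\omega=\frac i2\sum_j dz_j\wedge d\bar z_j$ (so $\omega(\mathbf u,\mathbf v)=\operatorname{Im}\sum_j\bar u_jv_j$) and $\Omega=dz_1\wedge dz_2\wedge dz_3$. A special Lagrangian $3$-fold is an oriented real $3$-dimensional submanifold $L$ calibrated by $\operatorname{Re}\Omega$; equivalently, a real $3$-submanifold (with a suitable orientation) on which $\omega|_L\equiv0$ and $\operatorname{Im}\Omega|_L\equiv0$. Cross product: $(r_1,r_2,r_3)\times(s_1,s_2,s_3)=\frac12(\bar r_2\bar s_3-\bar r_3\bar s_2,\ \bar r_3\bar s_1-\bar r_1\bar s_3,\ \bar r_1\bar s_2-\bar r_2\bar s_1)$. "Wherever it is nonsingular": $N$ is the image of the map of $(x,y,t)$ given by the displayed vector; the assertion concerns the points where $N$ is a nonsingular (immersed) $3$-submanifold, in particular where this map is an immersion. *)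

theory Defs
  imports "HOL-Analysis.Analysis"
begin

text \<open>
  The Euclidean metric of \<open>\<complex>\<^sup>3\<close> is the library inner product on \<^typ>\<open>complex^3\<close>.
  Below are the forms \<open>\<omega> = (i/2) (dz\<^sub>1 \<and> dz\<^sub>1' + dz\<^sub>2 \<and> dz\<^sub>2' + dz\<^sub>3 \<and> dz\<^sub>3')\<close>
  (with \<open>'\<close> for complex conjugation) and \<open>\<Omega> = dz\<^sub>1 \<and> dz\<^sub>2 \<and> dz\<^sub>3\<close>, evaluated on vectors.
\<close>

definition kaehler_form :: "complex^3 \<Rightarrow> complex^3 \<Rightarrow> real" where
  "kaehler_form u v = Im (\<Sum>j\<in>UNIV. cnj (u $ j) * v $ j)"

definition hol_volume_form :: "complex^3 \<Rightarrow> complex^3 \<Rightarrow> complex^3 \<Rightarrow> complex" where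
  "hol_volume_form u v w = det (vector [u, v, w] :: complex^3^3)"

definition ccross :: "complex^3 \<Rightarrow> complex^3 \<Rightarrow> complex^3" where
  "ccross r s = (1/2) *\<^sub>R vector
     [cnj (r$2) * cnj (s$3) - cnj (r$3) * cnj (s$2),
      cnj (r$3) * cnj (s$1) - cnj (r$1) * cnj (s$3),
      cnj (r$1) * cnj (s$2) - cnj (r$2) * cnj (s$1)]"

primrec Ck_on ::
    "nat \<Rightarrow> ('a::euclidean_space \<Rightarrow> 'b::real_normed_vector) \<Rightarrow> 'a set \<Rightarrow> bool" where
  "Ck_on 0 f U \<longleftrightarrow> continuous_on U f"
| "Ck_on (Suc n) f U \<longleftrightarrow>
     f differentiable_on U \<and> (\<forall>v. Ck_on n (\<lambda>x. frechet_derivative f (at x) v) U)"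

text \<open>Meant for open \<open>U\<close>, on which \<^const>\<open>Ck_on\<close> is the usual class \<open>C\<^sup>n\<close>.\<close>

definition smooth_on :: "('a::euclidean_space \<Rightarrow> 'b::real_normed_vector) \<Rightarrow> 'a set \<Rightarrow> bool" where
  "smooth_on f U \<longleftrightarrow> (\<forall>n. Ck_on n f U)"

definition immersion_at ::
    "('a::real_normed_vector \<Rightarrow> 'b::real_normed_vector) \<Rightarrow> 'a \<Rightarrow> bool" where
  "immersion_at f x \<longleftrightarrow> (\<exists>D. (f has_derivative D) (at x) \<and> inj D)"

text \<open>
  An immersed 3-fold in \<open>\<complex>\<^sup>3\<close> is a space \<open>X\<close> with a map \<open>\<iota>\<close> into \<open>\<complex>\<^sup>3\<close> that is a smooth
  immersion in suitable local coordinates of \<open>X\<close>. The smooth structure of \<open>X\<close> need not be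
  given separately: two charts as below automatically have a smooth transition map, since
  \<open>\<iota>\<close> composed with a chart has local smooth left inverses. Taking \<open>\<iota> = id\<close> on a subset
  \<open>X\<close> of \<open>\<complex>\<^sup>3\<close> (with the subspace topology) gives the embedded 3-dimensional submanifolds.
  A chart is written as a parametrization \<open>c\<close> of a relatively open piece of \<open>X\<close>
  by an open set \<open>U\<close> of \<open>\<real>\<^sup>3\<close>.
\<close>

definition immersed_chart ::
    "'a::{second_countable_topology,t2_space} set \<Rightarrow> ('a \<Rightarrow> complex^3)
      \<Rightarrow> (real^3) set \<Rightarrow> (real^3 \<Rightarrow> 'a) \<Rightarrow> bool" where
  "immersed_chart X \<iota> U c \<longleftrightarrow>
     open U \<and> openin (top_of_set X) (c ` U) \<and> (\<exists>c'. homeomorphism U (c ` U) c c') \<and>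
     smooth_on (\<iota> \<circ> c) U \<and> (\<forall>u\<in>U. immersion_at (\<iota> \<circ> c) u)"

definition immersed_3fold ::
    "'a::{second_countable_topology,t2_space} set \<Rightarrow> ('a \<Rightarrow> complex^3) \<Rightarrow> bool" where
  "immersed_3fold X \<iota> \<longleftrightarrow> (\<forall>x\<in>X. \<exists>U c. immersed_chart X \<iota> U c \<and> x \<in> c ` U)"

definition coordinate_frame :: "(real^3 \<Rightarrow> complex^3) \<Rightarrow> real^3 \<Rightarrow> complex^3^3" where
  "coordinate_frame f u = (\<chi> i. frechet_derivative f (at u) (axis i 1))"

definition cooriented_frames :: "complex^3^3 \<Rightarrow> (complex^3^3) set" where
  "cooriented_frames e =
     {e'. \<exists>B :: real^3^3. det B > 0 \<and> (\<forall>i. e' $ i = (\<Sum>j\<in>UNIV. B $ i $ j *\<^sub>R e $ j))}"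

text \<open>
  An orientation assigns to each point of \<open>X\<close> the set of positively oriented bases of its
  tangent space (regarded as a real subspace of \<open>\<complex>\<^sup>3\<close>), such that every point
  lies in a chart whose coordinate frame is positive throughout.
\<close>

definition oriented_3fold ::
    "'a::{second_countable_topology,t2_space} set \<Rightarrow> ('a \<Rightarrow> complex^3)
      \<Rightarrow> ('a \<Rightarrow> (complex^3^3) set) \<Rightarrow> bool" where
  "oriented_3fold X \<iota> ori \<longleftrightarrow>
     (\<forall>x\<in>X. \<exists>U c. immersed_chart X \<iota> U c \<and> x \<in> c ` U \<and>
        (\<forall>u\<in>U. ori (c u) = cooriented_frames (coordinate_frame (\<iota> \<circ> c) u)))"

definition orthonormal_frame :: "complex^3^3 \<Rightarrow> bool" where
  "orthonormal_frame e \<longleftrightarrow> (\<forall>i j. e $ i \<bullet> e $ j = (if i = j then 1 else 0))"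

text \<open>
  Calibrated by \<open>Re \<Omega>\<close>: \<open>Re \<Omega>\<close> restricts to the Riemannian volume form on every oriented tangent
  space, where the volume form is the alternating 3-form equal to 1 on positive orthonormal bases.
\<close>

definition special_lagrangian ::
    "'a::{second_countable_topology,t2_space} set \<Rightarrow> ('a \<Rightarrow> complex^3)
      \<Rightarrow> ('a \<Rightarrow> (complex^3^3) set) \<Rightarrow> bool" where
  "special_lagrangian X \<iota> ori \<longleftrightarrow>
     oriented_3fold X \<iota> ori \<and>
     (\<forall>x\<in>X. \<forall>e\<in>ori x. orthonormal_frame e \<longrightarrow>
        Re (hol_volume_form (e $ 1) (e $ 2) (e $ 3)) = 1)"

definition evolution_map ::
    "nat \<Rightarrow> (nat \<Rightarrow> real \<Rightarrow> complex^3) \<Rightarrow> (real \<Rightarrow> complex^3) \<Rightarrow> (real \<Rightarrow> complex^3)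
      \<Rightarrow> real \<Rightarrow> real \<Rightarrow> real \<Rightarrow> complex^3" where
  "evolution_map k p q1 q2 x y t =
     (\<Sum>j\<le>k. x ^ j *\<^sub>R p j t) + y *\<^sub>R q1 t + (x * y) *\<^sub>R q2 t"

end

theory Submission
  imports Defs
begin

text \<open>
  Let \<open>\<Phi>(x, y, t)\<close> be the displayed parametrization of \<open>N\<close>. Comparing coefficients of \<open>x\<close> and \<open>y\<close>, the
  evolution equations say exactly that \<open>\<Phi>\<^sub>t = 2 \<Phi>\<^sub>x \<times> \<Phi>\<^sub>y\<close>. The cross product \<open>u \<times> v\<close> is half the conjugate
  of the complex vector product, so it is \<open>\<omega>\<close>-orthogonal to \<open>u\<close> and \<open>v\<close>, and \<open>\<Omega>(u, v, u \<times> v)\<close> is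
  real. Hence \<open>\<omega>\<close> and \<open>Im \<Omega>\<close> pull back to zero under \<open>\<Phi>\<close>, at critical points too, as soon as
  \<open>\<omega>(\<Phi>\<^sub>x, \<Phi>\<^sub>y) = 0\<close>. At \<open>t = 0\<close> this is the assumption, and the \<open>t\<close>-derivative of the left-hand side is a
  sum of values of \<open>Im \<Omega>\<close> that cancel by antisymmetry (\<open>kaehler_form_conserved\<close>).

  It remains to pass from the map \<open>\<Phi>\<close> to an arbitrary immersed 3-fold \<open>X\<close> with image in \<open>N\<close>.
  Such an \<open>X\<close> need not be tangent to \<open>\<Phi>\<close> at every parameter: a point of \<open>N\<close> may be the image of
  critical points, and different sheets of \<open>\<Phi>\<close> may cross. But \<open>X\<close> is covered by countably many
  closed sets, each the part of \<open>X\<close> on a compact piece of \<open>\<Phi>\<close>; by the theorems of Baire and Sard, the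
  points of \<open>X\<close> at which some piece of \<open>\<Phi>\<close> contains an open part of \<open>X\<close> are dense
  (\<open>dense_tangency\<close>). There the tangent planes of \<open>X\<close> inherit the vanishing of \<open>\<omega>\<close> and
  \<open>Im \<Omega>\<close>, and by continuity all tangent planes of \<open>X\<close> do.

  On such a plane \<open>Re \<Omega>\<close> does not vanish, because a Lagrangian plane is totally real, and it takes the
  values \<open>\<plusminus>1\<close> on orthonormal frames, because these are unitary. The sign of \<open>Re \<Omega>\<close> therefore defines an
  orientation for which \<open>X\<close> is calibrated.
\<close>

section \<open>Tangent spaces of maps between Euclidean spaces\<close>

abbreviation (input) tangent_map :: "('a::real_normed_vector \<Rightarrow> 'b::real_normed_vector) \<Rightarrow> 'a \<Rightarrow> 'a \<Rightarrow> 'b" where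
  "tangent_map f u \<equiv> frechet_derivative f (at u)"

lemma Ck_on_subset: "Ck_on n f U \<Longrightarrow> V \<subseteq> U \<Longrightarrow> Ck_on n f V"
  by (induction n arbitrary: f) (auto intro: continuous_on_subset differentiable_on_subset)

lemma C1_has_derivative:
  assumes "Ck_on 1 f U" "open U" "u \<in> U"
  shows "(f has_derivative tangent_map f u) (at u)"
proof -
  have "f differentiable (at u within U)"
    using assms(1,3) by (simp add: differentiable_on_def)
  then show ?thesis
    unfolding at_within_open[OF assms(3,2)] by (simp only: frechet_derivative_works)
qed

lemma C1_continuous_on_tangent_map:
  assumes "Ck_on 1 f U"
  shows "continuous_on U (\<lambda>u. tangent_map f u v)"
  using assms by simp

lemma immersion_at_iff_inj:
  assumes "f differentiable (at u)"
  shows "immersion_at f u \<longleftrightarrow> inj (tangent_map f u)"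
  using assms unfolding immersion_at_def
  by (metis frechet_derivative_at frechet_derivative_works)

text \<open>
  A left inverse \<open>P\<close> of the derivative at \<open>w0\<close> turns \<open>F\<close> into a map \<open>P \<circ> F\<close> between spaces of
  equal dimension with invertible derivative at \<open>w0\<close>, so the inverse function theorem applies.
  A fixed linear projection \<open>P\<close> does the work of a local retraction onto the image of \<open>F\<close>.
\<close>

lemma C1_immersion_local_projection:
  fixes F :: "'a::euclidean_space \<Rightarrow> 'b::euclidean_space"
  assumes F: "Ck_on 1 F U" and U: "open U" and w0: "w0 \<in> U" and inj: "inj (tangent_map F w0)"
  obtains W V and P :: "'b \<Rightarrow> 'a" and g where "open W" "w0 \<in> W" "W \<subseteq> U" "open V" "bounded_linear P"
    "homeomorphism W V (P \<circ> F) g" "\<And>y. y \<in> V \<Longrightarrow> g differentiable (at y)"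
    "\<And>w. w \<in> W \<Longrightarrow> inj (tangent_map F w)"
proof -
  have der: "(F has_derivative tangent_map F w) (at w)" if "w \<in> U" for w
    using C1_has_derivative[OF F U that] .
  have lin: "linear (tangent_map F w0)"
    using der[OF w0] by (rule has_derivative_linear)
  obtain P where P: "linear P" and PF: "P \<circ> tangent_map F w0 = id"
    using linear_injective_left_inverse[OF lin inj] by blast
  have bP: "bounded_linear P" using P by (simp add: linear_conv_bounded_linear)
  define G' where "G' w = Blinfun (P \<circ> tangent_map F w)" for w
  have G': "blinfun_apply (G' w) = P \<circ> tangent_map F w" if "w \<in> U" for w
    unfolding G'_def
    by (rule bounded_linear_Blinfun_apply)
      (use bounded_linear_compose[OF bP has_derivative_bounded_linear[OF der[OF that]]] in \<open>simp add: o_def\<close>)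
  have cont: "continuous_on U G'"
  proof (rule continuous_on_blinfun_componentwise)
    fix i :: 'a
    have "continuous_on U (\<lambda>w. P (tangent_map F w i))"
      using bounded_linear.continuous_on[OF bP C1_continuous_on_tangent_map[OF F]] .
    then show "continuous_on U (\<lambda>w. G' w i)"
      by (rule continuous_on_eq) (simp add: G')
  qed
  have G'w0: "id_blinfun o\<^sub>L G' w0 = id_blinfun"
    by (rule blinfun_eqI) (use PF in \<open>simp add: G'[OF w0] fun_eq_iff\<close>)
  have derPF: "((P \<circ> F) has_derivative blinfun_apply (G' w)) (at w)" if "w \<in> U" for w
    unfolding G'[OF that]
    using bounded_linear.has_derivative[OF bP der[OF that]] by (simp add: o_def)
  obtain W V g g' where W: "open W" "W \<subseteq> U" "w0 \<in> W" and V: "open V" "(P \<circ> F) w0 \<in> V"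
    and hom: "homeomorphism W V (P \<circ> F) g"
    and g: "\<And>y. y \<in> V \<Longrightarrow> (g has_derivative (g' y)) (at y)"
    and "\<And>y. y \<in> V \<Longrightarrow> g' y = inv (blinfun_apply (G' (g y)))"
    and bij: "\<And>y. y \<in> V \<Longrightarrow> bij (blinfun_apply (G' (g y)))"
    by (rule inverse_function_theorem[OF U derPF cont w0 G'w0]; (assumption | (rule that; assumption)))
  have "inj (tangent_map F w)" if w: "w \<in> W" for w
  proof -
    have V: "(P \<circ> F) w \<in> V" and gw: "g ((P \<circ> F) w) = w"
      using hom w unfolding homeomorphism_def by blast+
    from bij[OF V] have "bij (P \<circ> tangent_map F w)"
      using G' w W(2) gw by auto
    then show ?thesis
      using bij_is_inj inj_on_imageI2 by blast
  qed
  moreover have "g differentiable (at y)" if "y \<in> V" for y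
    using g[OF that] by (auto simp: differentiable_def)
  ultimately show ?thesis
    using that W V(1) hom bP by blast
qed

text \<open>
  Near \<open>w0\<close> the map \<open>F\<close> has a differentiable left inverse defined on an open subset of the ambient
  space. Any differentiable \<open>f\<close> whose values stay in \<open>F ` W\<close> therefore factors differentiably
  through \<open>F\<close>, and the chain rule compares the tangent spaces. The map \<open>f\<close> ranges over all such
  maps inside the conclusion because \<open>W\<close> must be chosen before \<open>f\<close> when \<open>W\<close> is used in a cover.
\<close>

lemma C1_immersion_local_factor:
  fixes F :: "'a::euclidean_space \<Rightarrow> 'b::euclidean_space"
  assumes F: "Ck_on 1 F U" and U: "open U" and w0: "w0 \<in> U" and inj: "inj (tangent_map F w0)"
  obtains W where "open W" "w0 \<in> W" "W \<subseteq> U"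
    "\<And>w. w \<in> W \<Longrightarrow> inj (tangent_map F w)"
    "\<And>(f :: 'c::euclidean_space \<Rightarrow> 'b) D w u. open D \<Longrightarrow> u \<in> D \<Longrightarrow> f differentiable (at u) \<Longrightarrow> f ` D \<subseteq> F ` W
       \<Longrightarrow> w \<in> W \<Longrightarrow> F w = f u \<Longrightarrow> range (tangent_map f u) \<subseteq> range (tangent_map F w)"
proof -
  obtain W V and P :: "'b \<Rightarrow> 'a" and g where W: "open W" "w0 \<in> W" "W \<subseteq> U" "open V" and P: "bounded_linear P"
    and hom: "homeomorphism W V (P \<circ> F) g"
    and g: "\<And>y. y \<in> V \<Longrightarrow> g differentiable (at y)"
    and inj: "\<And>w. w \<in> W \<Longrightarrow> inj (tangent_map F w)"
    using C1_immersion_local_projection[OF assms] by blast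
  have gF: "g (P (F w)) = w" "P (F w) \<in> V" if "w \<in> W" for w
    using hom that unfolding homeomorphism_def by auto
  have "range (tangent_map f u) \<subseteq> range (tangent_map F w)"
    if D: "open D" "u \<in> D" and f: "f differentiable (at u)" "f ` D \<subseteq> F ` W" and w: "w \<in> W" "F w = f u"
    for f :: "'c \<Rightarrow> 'b" and D w u
  proof -
    have fac: "F (g (P (f u'))) = f u'" if "u' \<in> D" for u'
      using f(2) gF(1) that by force
    obtain g' where g': "(g has_derivative g') (at (P (f u)))"
      using g gF(2)[OF w(1)] w(2) unfolding differentiable_def by auto
    have f': "(f has_derivative tangent_map f u) (at u)"
      using f(1) frechet_derivative_works by blast
    have F': "(F has_derivative tangent_map F w) (at (g (P (f u))))"
      using C1_has_derivative[OF F U, of w] W w gF(1) by force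
    have Pf: "((\<lambda>x. P (f x)) has_derivative (\<lambda>h. P (tangent_map f u h))) (at u)"
      by (rule bounded_linear.has_derivative[OF P f'])
    have "((\<lambda>x. F (g (P (f x)))) has_derivative
        (\<lambda>h. tangent_map F w (g' (P (tangent_map f u h))))) (at u)"
      using has_derivative_compose[OF has_derivative_compose[OF Pf g'] F'] .
    then have "(f has_derivative (\<lambda>h. tangent_map F w (g' (P (tangent_map f u h))))) (at u)"
      by (rule has_derivative_transform_within_open[OF _ D]) (rule fac)
    from has_derivative_unique[OF f' this] show ?thesis
      by (metis image_subsetI rangeI)
  qed
  then show ?thesis
    by (intro that[of W] W inj)
qed

lemma C1_immersion_projection_open:
  fixes f :: "'a::euclidean_space \<Rightarrow> 'b::euclidean_space"
  assumes "Ck_on 1 f U" "open U" "u \<in> U" "inj (tangent_map f u)"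
  obtains P :: "'b \<Rightarrow> 'a" and V where "bounded_linear P" "open V" "V \<noteq> {}" "V \<subseteq> (P \<circ> f) ` U"
  by (rule C1_immersion_local_projection[OF assms])
    (metis empty_iff homeomorphism_image1 image_is_empty image_mono)

text \<open>
  In an ambient space of larger dimension the whole image of \<open>F\<close> is negligible. Only after a linear
  projection to the dimension of the parameter space does Sard's theorem separate critical
  points from the others.
\<close>

lemma negligible_projected_critical_image:
  fixes F :: "real^'n::{finite,wellorder} \<Rightarrow> 'b::euclidean_space" and P :: "'b \<Rightarrow> real^'n::_"
  assumes F: "\<And>w. w \<in> C \<Longrightarrow> F differentiable (at w)" and C: "\<And>w. w \<in> C \<Longrightarrow> \<not> inj (tangent_map F w)"
    and P: "bounded_linear P"
  shows "negligible ((P \<circ> F) ` C)"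
proof (rule baby_Sard)
  show "CARD('n) \<le> CARD('n)" by simp
  fix w assume w: "w \<in> C"
  have "((P \<circ> F) has_derivative (P \<circ> tangent_map F w)) (at w)"
    using bounded_linear.has_derivative[OF P] F[OF w] by (simp add: o_def frechet_derivative_works)
  then show "((P \<circ> F) has_derivative (P \<circ> tangent_map F w)) (at w within C)"
    by (rule has_derivative_at_withinI)
  have "linear (P \<circ> tangent_map F w)"
    using \<open>((P \<circ> F) has_derivative _) (at w)\<close> has_derivative_linear by blast
  moreover have "\<not> inj (P \<circ> tangent_map F w)"
    using C[OF w] inj_on_imageI2 by blast
  ultimately show "rank (matrix (P \<circ> tangent_map F w)) < CARD('n)"
    by (simp add: less_rank_noninjective)
qed

text \<open>
  Several sheets of \<open>F\<close> may cover the image of \<open>f\<close>, and a sheet through \<open>f u\<close> may cross it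
  transversally or be singular there, so tangency can be expected only at generic \<open>u\<close>. Cover the parameter space
  of \<open>F\<close> by countably many compact sets, each consisting of critical points or small enough for
  \<open>C1_immersion_local_factor\<close>. The preimages under \<open>f\<close> of their images are closed and cover \<open>U\<close>, so
  by the Baire category theorem one of them contains an open set. Critical points cannot account for
  it: a projection of \<open>f\<close> has open image there, while Sard's theorem makes the projected critical
  values negligible. Hence \<open>f\<close> factors through a single immersed sheet on that open set.
\<close>

lemma dense_tangency:
  fixes F :: "real^'n::{finite,wellorder} \<Rightarrow> 'b::euclidean_space" and f :: "real^'n::_ \<Rightarrow> 'b"
  assumes F: "Ck_on 1 F UNIV" and f: "Ck_on 1 f U" and U: "open U"
    and imm: "\<And>u. u \<in> U \<Longrightarrow> inj (tangent_map f u)" and sub: "f ` U \<subseteq> range F" and ne: "U \<noteq> {}"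
  obtains u w where "u \<in> U" "range (tangent_map f u) \<subseteq> range (tangent_map F w)"
proof (rule ccontr)
  assume contra: "\<not> thesis"
  define R where "R = {w. inj (tangent_map F w)}"
  have F': "F differentiable (at w)" for w
    by (rule differentiableI[OF C1_has_derivative[OF F open_UNIV UNIV_I]])
  have f': "f differentiable (at u)" if "u \<in> U" for u
    by (rule differentiableI[OF C1_has_derivative[OF f U that]])
  define tangential where "tangential W \<longleftrightarrow> (\<forall>D u w. open D \<longrightarrow> u \<in> D \<longrightarrow> D \<subseteq> U \<longrightarrow> f ` D \<subseteq> F ` W
      \<longrightarrow> w \<in> W \<longrightarrow> F w = f u \<longrightarrow> range (tangent_map f u) \<subseteq> range (tangent_map F w))" for W
  have "\<exists>W. open W \<and> w \<in> W \<and> W \<subseteq> R \<and> tangential W" if "w \<in> R" for w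
  proof -
    have inj: "inj (tangent_map F w)" using that by (simp add: R_def)
    show ?thesis
    proof (rule C1_immersion_local_factor[where 'c="real^'n::_", OF F open_UNIV UNIV_I inj])
      fix W
      assume W: "open W" "w \<in> W" "\<And>w. w \<in> W \<Longrightarrow> inj (tangent_map F w)"
        and fac: "\<And>(f :: real^'n::_ \<Rightarrow> 'b) D w u. open D \<Longrightarrow> u \<in> D \<Longrightarrow> f differentiable (at u)
          \<Longrightarrow> f ` D \<subseteq> F ` W \<Longrightarrow> w \<in> W \<Longrightarrow> F w = f u
          \<Longrightarrow> range (tangent_map f u) \<subseteq> range (tangent_map F w)"
      have "tangential W"
        unfolding tangential_def by (intro allI impI) (rule fac, assumption+, rule f', erule (1) subsetD)
      moreover have "W \<subseteq> R" using W(3) by (auto simp: R_def)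
      ultimately show ?thesis using W(1,2) by blast
    qed
  qed
  then obtain W where W: "\<And>w. w \<in> R \<Longrightarrow> open (W w)" "\<And>w. w \<in> R \<Longrightarrow> w \<in> W w" "\<And>w. w \<in> R \<Longrightarrow> W w \<subseteq> R"
    and WF: "\<And>w. w \<in> R \<Longrightarrow> tangential (W w)"
    by metis
  have "\<exists>e>0. cball w e \<subseteq> W w" if "w \<in> R" for w
    using W(1,2)[OF that] open_contains_cball by blast
  then obtain e where e: "\<And>w. w \<in> R \<Longrightarrow> e w > 0" "\<And>w. w \<in> R \<Longrightarrow> cball w (e w) \<subseteq> W w"
    by metis
  have "open (\<Union>w\<in>R. W w)" using W(1) by blast
  also have "(\<Union>w\<in>R. W w) = R" using W(2,3) by blast
  finally have "open R" .
  have ops: "open S" if "S \<in> (\<lambda>w. ball w (e w)) ` R" for S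
    using that by blast
  obtain \<B> where \<B>: "\<B> \<subseteq> (\<lambda>w. ball w (e w)) ` R" "countable \<B>" "\<Union>\<B> = (\<Union>w\<in>R. ball w (e w))"
    by (rule Lindelof[OF ops])
  have "\<exists>R'. countable R' \<and> R' \<subseteq> R \<and> \<B> = (\<lambda>w. ball w (e w)) ` R'"
    by (rule countable_subset_image[THEN iffD1]) (rule conjI[OF \<B>(2,1)])
  then obtain R' where R': "R' \<subseteq> R" "countable R'" "\<B> = (\<lambda>w. ball w (e w)) ` R'"
    by blast
  have cover: "R \<subseteq> (\<Union>w\<in>R'. cball w (e w))"
  proof
    fix w assume "w \<in> R"
    then have "w \<in> (\<Union>w\<in>R. ball w (e w))"
      using e(1) centre_in_ball by blast
    then have "w \<in> (\<Union>w\<in>R'. ball w (e w))"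
      unfolding \<B>(3)[symmetric] R'(3) .
    then show "w \<in> (\<Union>w\<in>R'. cball w (e w))"
      using ball_subset_cball by blast
  qed
  \<comment> \<open>Intersecting with balls makes the closed set of critical points a countable union of compact
    sets, whose images are closed.\<close>
  define \<K> where "\<K> = (\<lambda>w. cball w (e w)) ` R' \<union> range (\<lambda>n::nat. cball 0 (real n) - R)"
  have "countable \<K>" unfolding \<K>_def using R'(2) by simp
  have comp: "compact K" if "K \<in> \<K>" for K
    using that \<open>open R\<close> unfolding \<K>_def by (auto simp: compact_diff)
  have covK: "\<Union>\<K> = UNIV"
  proof -
    have "w \<in> \<Union>\<K>" for w
    proof (cases "w \<in> R")
      case True then show ?thesis using cover unfolding \<K>_def by blast
    next
      case False
      obtain n :: nat where "norm w \<le> real n" using real_arch_simple by blast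
      then have "w \<in> cball 0 (real n) - R" using False by simp
      then show ?thesis unfolding \<K>_def by blast
    qed
    then show ?thesis by blast
  qed
  obtain u0 where "u0 \<in> U" using ne by blast
  then obtain d where d: "d > 0" "cball u0 d \<subseteq> U"
    using U open_contains_cball by blast
  define B where "B = cball u0 d"
  \<comment> \<open>The Baire argument takes place in a closed ball, so that the preimages are closed in the
    whole space.\<close>
  define \<G> where "\<G> = (\<lambda>K. B \<inter> f -` (F ` K)) ` \<K>"
  have contF: "continuous_on UNIV F"
    by (intro continuous_at_imp_continuous_on ballI differentiable_imp_continuous_within F')
  have contf: "continuous_on B f"
    using d(2) unfolding B_def
    by (intro continuous_at_imp_continuous_on ballI differentiable_imp_continuous_within f') (rule subsetD)
  have clo: "closed G" if G: "G \<in> \<G>" for G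
  proof -
    obtain K where K: "K \<in> \<K>" "G = B \<inter> f -` (F ` K)" 
      using G unfolding \<G>_def by blast
    have "closed (F ` K)"
      by (rule compact_imp_closed[OF compact_continuous_image[OF continuous_on_subset[OF contF subset_UNIV] comp[OF K(1)]]])
    then show ?thesis
      unfolding K(2) by (intro continuous_closed_preimage contf) (simp add: B_def)
  qed
  have "B \<subseteq> \<Union>\<G>"
  proof
    fix u assume u: "u \<in> B"
    then have "f u \<in> range F" using sub d(2) unfolding B_def by blast
    then obtain w where "f u = F w" by blast
    moreover obtain K where "K \<in> \<K>" "w \<in> K" using covK by blast
    ultimately show "u \<in> \<Union>\<G>" using u unfolding \<G>_def by blast
  qed
  have "\<exists>G\<in>\<G>. interior G \<noteq> {}"
  proof (rule ccontr)
    assume thin: "\<not> ?thesis"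
    have "euclidean interior_of \<Union>\<G> = {}"
    proof (rule Baire_category_alt)
      show "countable \<G>" unfolding \<G>_def using \<open>countable \<K>\<close> by (rule countable_image)
      show "closedin euclidean G \<and> euclidean interior_of G = {}" if "G \<in> \<G>" for G
      proof
        show "closedin euclidean G" using clo[OF that] unfolding closed_closedin .
        show "euclidean interior_of G = {}"
          unfolding euclidean_interior_of using thin that by blast
      qed
    qed (rule disjI1, rule completely_metrizable_space_euclidean)
    then have "interior B = {}"
      unfolding euclidean_interior_of using interior_mono[OF \<open>B \<subseteq> \<Union>\<G>\<close>] by blast
    then show False using d(1) unfolding B_def by simp
  qed
  then obtain G where G: "G \<in> \<G>" "interior G \<noteq> {}"
    by (rule bexE)
  from G(1) obtain K where GK: "G = B \<inter> f -` (F ` K)" and K: "K \<in> \<K>"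
    unfolding \<G>_def by (rule imageE)
  define D where "D = interior G"
  have DB: "D \<subseteq> B \<inter> f -` (F ` K)" unfolding D_def GK[symmetric] by (rule interior_subset)
  have D: "open D" "D \<noteq> {}" "D \<subseteq> U" "f ` D \<subseteq> F ` K"
  proof -
    show "open D" "D \<noteq> {}" using G(2) unfolding D_def by simp_all
    show "D \<subseteq> U" using DB d(2) unfolding B_def by blast
    show "f ` D \<subseteq> F ` K" using DB by blast
  qed
  obtain u where u: "u \<in> D" using D(2) by blast
  from K consider (reg) "K \<in> (\<lambda>w. cball w (e w)) ` R'" | (crit) "K \<in> range (\<lambda>n::nat. cball 0 (real n) - R)"
    unfolding \<K>_def by (rule UnE)
  then show False
  proof cases
    case reg
    then obtain w where w: "w \<in> R" "K = cball w (e w)" using R'(1) by (elim imageE) (auto dest: subsetD)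
    have sub: "f ` D \<subseteq> F ` W w" using D(4) image_mono[OF e(2)[OF w(1)], of F] unfolding w(2) by (rule order_trans)
    have "f u \<in> F ` W w" using sub u by (rule subsetD[OF _ imageI])
    then obtain w' where "w' \<in> W w" "F w' = f u" by force
    then have "range (tangent_map f u) \<subseteq> range (tangent_map F w')"
      using WF[OF w(1)] D(1,3) u sub unfolding tangential_def by simp
    moreover have "u \<in> U" using u D(3) by blast
    ultimately show False using contra that by blast
  next
    case crit
    have fD: "Ck_on 1 f D"
      using Ck_on_subset[OF f D(3)] .
    have inj: "inj (tangent_map f u)" using imm u D(3) by blast
    obtain P :: "'b \<Rightarrow> real^'n::_" and V where P: "bounded_linear P" "open V" "V \<noteq> {}" "V \<subseteq> (P \<circ> f) ` D"
      by (rule C1_immersion_projection_open[OF fD D(1) u inj])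
    have "(P \<circ> f) ` D \<subseteq> (P \<circ> F) ` K"
      using image_mono[OF D(4), of P] by (simp add: image_comp)
    moreover have "negligible ((P \<circ> F) ` K)"
    proof (rule negligible_projected_critical_image[OF F' _ P(1)])
      show "\<not> inj (tangent_map F w)" if "w \<in> K" for w
        using crit that by (auto simp: R_def)
    qed
    ultimately show False
      using open_not_negligible[OF P(2,3)] negligible_subset P(4) by (metis order_trans)
  qed
qed

section \<open>Linear algebra of special Lagrangian planes\<close>

lemma kaehler_form_bounded_bilinear: "bounded_bilinear kaehler_form"
  unfolding bilinear_conv_bounded_bilinear[symmetric]
  by (auto simp: bilinear_def kaehler_form_def sum_3 algebra_simps intro!: linearI)

lemma ccross_bounded_bilinear: "bounded_bilinear ccross"
  unfolding bilinear_conv_bounded_bilinear[symmetric]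
  by (auto simp: bilinear_def ccross_def vec_eq_iff forall_3 complex_eq_iff algebra_simps intro!: linearI)

interpretation kaehler_form: bounded_bilinear kaehler_form
  by (rule kaehler_form_bounded_bilinear)

interpretation ccross: bounded_bilinear ccross
  by (rule ccross_bounded_bilinear)

lemma ccross_self [simp]: "ccross u u = 0"
  by (simp add: ccross_def vec_eq_iff forall_3)

lemma ccross_skew: "ccross v u = - ccross u v"
  by (simp add: ccross_def vec_eq_iff forall_3 scaleR_minus_right[symmetric] mult.commute del: scaleR_minus_right)

lemma kaehler_form_skew: "kaehler_form u v = - kaehler_form v u"
  by (simp add: kaehler_form_def sum_3 algebra_simps)

lemma kaehler_form_self [simp]: "kaehler_form u u = 0"
  using kaehler_form_skew[of u u] by simp

lemma hol_volume_form_expand: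
  "hol_volume_form u v w =
     u$1 * v$2 * w$3 + u$2 * v$3 * w$1 + u$3 * v$1 * w$2
     - u$1 * v$3 * w$2 - u$2 * v$1 * w$3 - u$3 * v$2 * w$1"
  by (simp add: hol_volume_form_def det_3)

lemma hol_volume_form_det: "hol_volume_form (e $ 1) (e $ 2) (e $ 3) = det e"
  by (simp add: hol_volume_form_expand det_3)

text \<open>
  The cross product is half the conjugate of the complex vector product, so pairing it with \<open>u\<close>
  gives half the conjugate of the complex determinant. This identity makes every cancellation
  in the evolution a matter of antisymmetry of \<open>\<Omega>\<close>.
\<close>

lemma kaehler_form_ccross:
  "kaehler_form u (ccross v w) = - (1/2) * Im (hol_volume_form u v w)"
  by (simp add: hol_volume_form_expand kaehler_form_def ccross_def sum_3 field_simps)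

lemma hol_volume_form_repeat [simp]:
  "hol_volume_form u u v = 0" "hol_volume_form u v u = 0"
  by (simp_all add: hol_volume_form_expand)

lemma kaehler_form_ccross_self [simp]:
  "kaehler_form u (ccross u v) = 0" "kaehler_form v (ccross u v) = 0"
  by (simp_all add: kaehler_form_ccross)

lemma hol_volume_form_ccross_real: "Im (hol_volume_form u v (ccross u v)) = 0"
  by (simp add: hol_volume_form_expand ccross_def algebra_simps)

text \<open>
  The image of \<open>T\<close> need not have dimension 3, so that the notion is a closed condition which also makes
  sense at critical points. If \<open>T\<close> is injective, the image is a special Lagrangian plane up to
  orientation.
\<close>

definition special_isotropic :: "(real^3 \<Rightarrow> complex^3) \<Rightarrow> bool" where
  "special_isotropic T \<longleftrightarrow> (\<forall>a b. kaehler_form (T a) (T b) = 0) \<and>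
     (\<forall>a b c. Im (hol_volume_form (T a) (T b) (T c)) = 0)"

lemma linear_axis_expand:
  fixes T :: "real^3 \<Rightarrow> 'b::real_vector"
  assumes "linear T"
  shows "T a = (\<Sum>i\<in>UNIV. (a $ i) *\<^sub>R T (axis i 1))"
proof -
  have "T (\<Sum>i\<in>UNIV. (a $ i) *\<^sub>R axis i 1) = (\<Sum>i\<in>UNIV. (a $ i) *\<^sub>R T (axis i 1))"
    by (simp add: linear_sum[OF assms] linear_scale[OF assms])
  then show ?thesis
    by (simp add: basis_expansion scalar_mult_eq_scaleR[symmetric])
qed

lemma hol_volume_form_linear_image:
  fixes T :: "real^3 \<Rightarrow> complex^3"
  assumes T: "linear T"
  shows "hol_volume_form (T a) (T b) (T c) = of_real (det (vector [a, b, c] :: real^3^3))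
    * hol_volume_form (T (axis 1 1)) (T (axis 2 1)) (T (axis 3 1))"
proof -
  have "vector [T a, T b, T c] = (\<chi> i j. of_real ((vector [a, b, c] :: real^3^3) $ i $ j))
      ** (vector [T (axis 1 1), T (axis 2 1), T (axis 3 1)] :: complex^3^3)"
    unfolding linear_axis_expand[OF T, of a] linear_axis_expand[OF T, of b] linear_axis_expand[OF T, of c]
    by (simp add: vec_eq_iff forall_3 matrix_matrix_mult_def sum_3 scaleR_conv_of_real[where 'a=complex])
  moreover have "det (\<chi> i j. of_real (M $ i $ j) :: complex^3^3) = of_real (det M)" for M :: "real^3^3"
    by (simp add: det_3)
  ultimately show ?thesis
    by (simp add: hol_volume_form_def det_mul)
qed

text \<open>
  Both forms are determined by their values on the frame \<open>X, Y, 2 (X \<times> Y)\<close>, and the only value that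
  does not vanish by the properties of the cross product is \<open>\<omega>(X, Y)\<close>.
\<close>

lemma special_isotropic_of_frame:
  fixes T :: "real^3 \<Rightarrow> complex^3"
  assumes T: "linear T" and X: "T (axis 1 1) = X" and Y: "T (axis 2 1) = Y"
    and Z: "T (axis 3 1) = 2 *\<^sub>R ccross X Y" and XY: "kaehler_form X Y = 0"
  shows "special_isotropic T"
proof -
  have "kaehler_form Y X = 0" using kaehler_form_skew[of Y X] XY by simp
  moreover have "kaehler_form (ccross X Y) X = 0" "kaehler_form (ccross X Y) Y = 0"
    by (subst kaehler_form_skew, simp)+
  ultimately have "kaehler_form (T a) (T b) = 0" for a b
    unfolding linear_axis_expand[OF T, of a] linear_axis_expand[OF T, of b]
    using XY by (simp add: sum_3 X Y Z kaehler_form.add_left kaehler_form.add_right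
        kaehler_form.scaleR_left kaehler_form.scaleR_right)
  moreover have "Im (hol_volume_form X Y (2 *\<^sub>R ccross X Y)) = 0"
    using hol_volume_form_ccross_real[of X Y]
    by (simp add: hol_volume_form_def det_3)
  ultimately show ?thesis
    unfolding special_isotropic_def hol_volume_form_linear_image[OF T] X Y Z by simp
qed

text \<open>
  A Lagrangian plane is totally real: if \<open>T a + \<i> T b = 0\<close>, then \<open>\<omega>(T a, T b)\<close> is the squared norm of
  \<open>T b\<close>, so isotropy forces \<open>T a = T b = 0\<close>. Hence vectors that are independent over the reals are
  independent over the complex numbers.
\<close>

lemma hol_volume_form_nonzero_of_isotropic:
  fixes T :: "real^3 \<Rightarrow> complex^3"
  assumes T: "linear T" "inj T" and iso: "\<And>a b. kaehler_form (T a) (T b) = 0"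
  shows "hol_volume_form (T (axis 1 1)) (T (axis 2 1)) (T (axis 3 1)) \<noteq> 0"
proof
  define E :: "complex^3^3" where "E = (\<chi> i. T (axis i 1))"
  assume "hol_volume_form (T (axis 1 1)) (T (axis 2 1)) (T (axis 3 1)) = 0"
  then have "det (transpose E) = 0"
    using hol_volume_form_det[of E] by (simp add: E_def)
  then have "\<not> (\<exists>B. B ** transpose E = mat 1)"
    using invertible_det_nz invertible_left_inverse by blast
  then obtain z where z: "transpose E *v z = 0" "z \<noteq> 0"
    unfolding matrix_left_invertible_ker by blast
  define a b where "a = (\<chi> i. Re (z $ i))" and "b = (\<chi> i. Im (z $ i))"
  have eq: "T a $ j + \<i> * T b $ j = 0" for j
  proof -
    have "T a $ j + \<i> * T b $ j = (\<Sum>i\<in>UNIV. E $ i $ j * z $ i)"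
      unfolding linear_axis_expand[OF T(1), of a] linear_axis_expand[OF T(1), of b]
      by (simp add: sum_3 E_def a_def b_def complex_eq_iff algebra_simps)
    also have "\<dots> = (transpose E *v z) $ j"
      by (simp add: matrix_vector_mult_def transpose_def)
    finally show ?thesis using z by simp
  qed
  have "kaehler_form (T a) (T b) = T b \<bullet> T b"
  proof -
    have "Im (cnj (T a $ j) * T b $ j) = T b $ j \<bullet> T b $ j" for j
    proof -
      have "T a $ j = - \<i> * T b $ j" using eq[of j] by (simp add: eq_neg_iff_add_eq_0)
      then show ?thesis by (simp add: inner_complex_def)
    qed
    then show ?thesis by (simp add: kaehler_form_def inner_vec_def)
  qed
  then have "T b = 0" using iso by simp
  moreover from this have "T a = 0" using eq by (simp add: vec_eq_iff)
  ultimately have "a = 0" "b = 0"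
    using T linear_injective_0 by blast+
  then have "z = 0"
    by (simp add: a_def b_def vec_eq_iff complex_eq_iff)
  with z(2) show False by simp
qed

text \<open>
  The real and imaginary parts of the Hermitian product are the Euclidean metric and \<open>\<omega>\<close>, so
  the frame is a unitary matrix.
\<close>

lemma norm_hol_volume_form_orthonormal_isotropic:
  assumes e: "orthonormal_frame e" and iso: "\<And>i j. kaehler_form (e $ i) (e $ j) = 0"
  shows "norm (hol_volume_form (e $ 1) (e $ 2) (e $ 3)) = 1"
proof -
  define A :: "complex^3^3" where "A = (\<chi> i j. cnj (e $ j $ i))"
  have "(e ** A) $ i $ k = mat 1 $ i $ k" for i k
  proof -
    define h where "h = (\<Sum>j\<in>UNIV. cnj (e $ i $ j) * e $ k $ j)"
    have "(e ** A) $ i $ k = cnj h"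
      by (simp add: matrix_matrix_mult_def A_def h_def)
    moreover have "Im h = 0"
      using iso[of i k] by (simp only: kaehler_form_def h_def)
    moreover have "Re h = e $ i \<bullet> e $ k"
      by (simp add: inner_vec_def inner_complex_def h_def)
    then have "Re h = (if i = k then 1 else 0)"
      using e by (simp add: orthonormal_frame_def)
    ultimately show ?thesis
      by (simp add: mat_def complex_eq_iff)
  qed
  then have "e ** A = mat 1" by (simp add: vec_eq_iff)
  then have "det e * det A = 1" by (metis det_mul det_I)
  moreover have "det A = cnj (det e)" by (simp add: A_def det_3 algebra_simps)
  ultimately have "(norm (det e))\<^sup>2 = 1"
    by (metis complex_norm_square of_real_eq_1_iff)
  then show ?thesis unfolding hol_volume_form_det by (simp add: abs_square_eq_1)
qed

text \<open>
  On the right-hand side the frame \<open>E\<close> enters only through the plane it spans. An orientation defined by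
  the right-hand side is therefore independent of charts once tangent planes are.
\<close>

lemma cooriented_frames_eq:
  fixes T :: "real^3 \<Rightarrow> complex^3"
  assumes T: "linear T" and E: "E = (\<chi> i. T (axis i 1))"
    and im: "Im (hol_volume_form (E $ 1) (E $ 2) (E $ 3)) = 0"
    and pos: "Re (hol_volume_form (E $ 1) (E $ 2) (E $ 3)) > 0"
  shows "cooriented_frames E
    = {e. (\<forall>i. e $ i \<in> range T) \<and> Re (hol_volume_form (e $ 1) (e $ 2) (e $ 3)) > 0}" (is "_ = ?R")
proof -
  have exp: "(\<Sum>j\<in>UNIV. B $ i $ j *\<^sub>R E $ j) = T (B $ i)" for B :: "real^3^3" and i
    by (subst linear_axis_expand[OF T]) (simp add: E)
  have vol: "Re (hol_volume_form (T (B $ 1)) (T (B $ 2)) (T (B $ 3)))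
      = det B * Re (hol_volume_form (E $ 1) (E $ 2) (E $ 3))" for B :: "real^3^3"
  proof -
    have "vector [B $ 1, B $ 2, B $ 3] = B" by (simp add: vec_eq_iff forall_3)
    then show ?thesis by (subst hol_volume_form_linear_image[OF T]) (simp add: E)
  qed
  show ?thesis
  proof (intro set_eqI iffI)
    fix e assume "e \<in> cooriented_frames E"
    then obtain B :: "real^3^3" where "det B > 0" "\<And>i. e $ i = T (B $ i)"
      unfolding cooriented_frames_def exp by blast
    then show "e \<in> ?R" using vol[of B] pos by simp
  next
    fix e assume e: "e \<in> ?R"
    then have "\<forall>i. \<exists>b. e $ i = T b" by blast
    then obtain b where b: "\<And>i. e $ i = T (b i)" by metis
    define B where "B = (\<chi> i. b i)"
    have "e $ i = T (B $ i)" for i using b by (simp add: B_def)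
    moreover from this have "det B > 0"
      using e vol[of B] pos by (simp add: zero_less_mult_iff)
    ultimately show "e \<in> cooriented_frames E"
      unfolding cooriented_frames_def exp by blast
  qed
qed

section \<open>Immersed 3-folds with isotropic tangent planes\<close>

lemma immersed_chartD:
  assumes "immersed_chart X \<iota> U c"
  shows "open U" "openin (top_of_set X) (c ` U)" "Ck_on 1 (\<iota> \<circ> c) U"
    "\<And>u. u \<in> U \<Longrightarrow> inj (tangent_map (\<iota> \<circ> c) u)"
    "\<And>u. u \<in> U \<Longrightarrow> ((\<iota> \<circ> c) has_derivative tangent_map (\<iota> \<circ> c) u) (at u)"
    "\<And>u. u \<in> U \<Longrightarrow> linear (tangent_map (\<iota> \<circ> c) u)"
proof -
  show "open U" "openin (top_of_set X) (c ` U)" "Ck_on 1 (\<iota> \<circ> c) U"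
    using assms unfolding immersed_chart_def smooth_on_def by blast+
  show der: "((\<iota> \<circ> c) has_derivative tangent_map (\<iota> \<circ> c) u) (at u)" if "u \<in> U" for u
    by (rule C1_has_derivative[OF \<open>Ck_on 1 _ U\<close> \<open>open U\<close> that])
  show "linear (tangent_map (\<iota> \<circ> c) u)" if "u \<in> U" for u
    by (rule has_derivative_linear[OF der[OF that]])
  show "inj (tangent_map (\<iota> \<circ> c) u)" if "u \<in> U" for u
  proof -
    have "immersion_at (\<iota> \<circ> c) u"
      using assms that unfolding immersed_chart_def by blast
    then show ?thesis
      using immersion_at_iff_inj[OF differentiableI[OF der[OF that]]] by blast
  qed
qed

lemma immersed_chart_subset:
  assumes chart: "immersed_chart X \<iota> U c" and V: "open V" "V \<subseteq> U"
  shows "immersed_chart X \<iota> V c"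
proof -
  obtain c' where hom: "homeomorphism U (c ` U) c c'"
    using chart unfolding immersed_chart_def by blast
  have "openin (top_of_set U) V"
    using V by (simp add: openin_open_eq immersed_chartD(1)[OF chart] Int_absorb1)
  then have "openin (top_of_set (c ` U)) (c ` V)"
    by (rule homeomorphism_imp_open_map[OF hom])
  then have "openin (top_of_set X) (c ` V)"
    using immersed_chartD(2)[OF chart] by (rule openin_trans)
  moreover have "homeomorphism V (c ` V) c c'"
    by (rule homeomorphism_of_subsets[OF hom V(2) image_mono[OF V(2)] refl])
  moreover have "smooth_on (\<iota> \<circ> c) V"
    using chart Ck_on_subset[OF _ V(2)] unfolding immersed_chart_def smooth_on_def by blast
  moreover have "\<forall>u\<in>V. immersion_at (\<iota> \<circ> c) u"
    using chart V(2) unfolding immersed_chart_def by blast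
  ultimately show ?thesis
    unfolding immersed_chart_def using V(1) by blast
qed

lemma Ck_on_cong:
  assumes "open U" "\<And>x. x \<in> U \<Longrightarrow> f x = g x" "Ck_on n f U"
  shows "Ck_on n g U"
  using assms(2,3)
proof (induction n arbitrary: f g)
  case 0
  then show ?case using continuous_on_cong by (metis Ck_on.simps(1))
next
  case (Suc n)
  have df: "f differentiable_on U" using Suc.prems(2) by simp
  have "g differentiable_on U"
    unfolding differentiable_on_def
  proof
    fix x assume x: "x \<in> U"
    with df show "g differentiable (at x within U)"
      unfolding differentiable_on_def
      by (metis differentiable_def has_derivative_transform Suc.prems(1))
  qed
  moreover have "Ck_on n (\<lambda>x. frechet_derivative g (at x) v) U" for v
  proof (rule Suc.IH)
    show "Ck_on n (\<lambda>x. frechet_derivative f (at x) v) U" using Suc.prems(2) by simp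
    fix x assume x: "x \<in> U"
    have "f differentiable (at x)"
      using df x \<open>open U\<close> differentiable_on_eq_differentiable_at by blast
    then have "frechet_derivative f (at x) = frechet_derivative g (at x)"
      by (rule frechet_derivative_transform_within_open[OF _ \<open>open U\<close> x]) (rule Suc.prems(1))
    then show "frechet_derivative f (at x) v = frechet_derivative g (at x) v" by simp
  qed
  ultimately show ?case by simp
qed

lemma tangent_map_comp_uminus:
  assumes "f differentiable (at (- u))"
  shows "tangent_map (f \<circ> uminus) u = (\<lambda>v. tangent_map f (- u) (- v))"
  using frechet_derivative_compose[of uminus u f] assms
  by (simp add: fun_eq_iff frechet_derivative_at[symmetric, OF has_derivative_minus[OF has_derivative_ident]])

lemma Ck_on_comp_uminus:
  assumes "open U" "Ck_on n f U"
  shows "Ck_on n (f \<circ> uminus) (uminus ` U)"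
  using assms(2)
proof (induction n arbitrary: f)
  case 0
  then have "continuous_on (uminus ` uminus ` U) f" by (simp add: image_image)
  then show ?case
    by (simp only: Ck_on.simps(1)) (intro continuous_on_compose continuous_intros)
next
  case (Suc n)
  have df: "f differentiable (at x)" if "x \<in> U" for x
    using Suc.prems that \<open>open U\<close> differentiable_on_eq_differentiable_at by (metis Ck_on.simps(2))
  have op: "open (uminus ` U)" using \<open>open U\<close> by (rule open_negations)
  have "(f \<circ> uminus) differentiable (at x)" if "x \<in> uminus ` U" for x
    using that by (intro differentiable_chain_at df differentiable_minus differentiable_ident) auto
  then have "(f \<circ> uminus) differentiable_on (uminus ` U)"
    using op differentiable_on_eq_differentiable_at by blast
  moreover have "Ck_on n (\<lambda>x. frechet_derivative (f \<circ> uminus) (at x) v) (uminus ` U)" for v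
  proof (rule Ck_on_cong[OF op])
    show "Ck_on n ((\<lambda>x. frechet_derivative f (at x) (- v)) \<circ> uminus) (uminus ` U)"
      using Suc.prems by (intro Suc.IH) simp
    fix x assume "x \<in> uminus ` U"
    then have "f differentiable (at (- x))" using df by auto
    then show "((\<lambda>x. frechet_derivative f (at x) (- v)) \<circ> uminus) x = frechet_derivative (f \<circ> uminus) (at x) v"
      by (simp add: tangent_map_comp_uminus)
  qed
  ultimately show ?case unfolding Ck_on.simps by blast
qed

text \<open>
  In odd dimension \<open>- id\<close> reverses orientation, so precomposing with it is enough to
  obtain charts of both orientations.
\<close>

lemma immersed_chart_uminus:
  assumes chart: "immersed_chart X \<iota> U c"
  shows "immersed_chart X \<iota> (uminus ` U) (c \<circ> uminus)"
proof -
  note [simp] = image_comp[symmetric] image_image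
  obtain c' where hom: "homeomorphism U (c ` U) c c'"
    using chart unfolding immersed_chart_def by blast
  have "homeomorphism (uminus ` U) U uminus uminus"
    by (rule homeomorphismI) (auto intro!: continuous_intros)
  from homeomorphism_compose[OF this hom]
  have "homeomorphism (uminus ` U) (c ` U) (c \<circ> uminus) (uminus \<circ> c')" .
  moreover have "(c \<circ> uminus) ` uminus ` U = c ` U" by simp
  moreover have "smooth_on (\<iota> \<circ> (c \<circ> uminus)) (uminus ` U)"
    using chart Ck_on_comp_uminus[OF immersed_chartD(1)[OF chart]]
    unfolding immersed_chart_def smooth_on_def o_assoc by blast
  moreover have "immersion_at (\<iota> \<circ> (c \<circ> uminus)) u" if "u \<in> uminus ` U" for u
  proof -
    have u: "- u \<in> U" using that by auto
    have d: "(\<iota> \<circ> c) differentiable (at (- u))"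
      using immersed_chartD(5)[OF chart u] differentiableI by blast
    have "(\<iota> \<circ> c \<circ> uminus) differentiable (at u)"
      by (intro differentiable_chain_at d differentiable_minus differentiable_ident)
    moreover have "inj (\<lambda>v. tangent_map (\<iota> \<circ> c) (- u) (- v))"
      using immersed_chartD(4)[OF chart u] unfolding inj_def by (metis neg_equal_iff_equal)
    ultimately show ?thesis
      unfolding o_assoc using immersion_at_iff_inj tangent_map_comp_uminus[OF d] by metis
  qed
  ultimately show ?thesis
    using chart open_negations unfolding immersed_chart_def by auto
qed

text \<open>
  The charts are homeomorphisms onto open subsets of \<open>X\<close>, so points near \<open>c1 u1\<close> lie in the second
  chart close to \<open>u2\<close>, even when \<open>\<iota>\<close> is not injective. Hence \<open>\<iota> \<circ> c1\<close> locally factors through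
  \<open>\<iota> \<circ> c2\<close> near \<open>u2\<close>.
\<close>

lemma chart_tangent_range_subset:
  assumes chart1: "immersed_chart X \<iota> U1 c1" and chart2: "immersed_chart X \<iota> U2 c2"
    and u1: "u1 \<in> U1" and u2: "u2 \<in> U2" and eq: "c1 u1 = c2 u2"
  shows "range (tangent_map (\<iota> \<circ> c1) u1) \<subseteq> range (tangent_map (\<iota> \<circ> c2) u2)"
proof (rule C1_immersion_local_factor[where 'c="real^3", OF immersed_chartD(3,1)[OF chart2] u2
    immersed_chartD(4)[OF chart2 u2]])
  fix W
  assume W: "open W" "u2 \<in> W" "W \<subseteq> U2"
    and fac: "\<And>(f :: real^3 \<Rightarrow> complex^3) D w u. open D \<Longrightarrow> u \<in> D \<Longrightarrow> f differentiable (at u)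
       \<Longrightarrow> f ` D \<subseteq> (\<iota> \<circ> c2) ` W \<Longrightarrow> w \<in> W \<Longrightarrow> (\<iota> \<circ> c2) w = f u
       \<Longrightarrow> range (tangent_map f u) \<subseteq> range (tangent_map (\<iota> \<circ> c2) w)"
  obtain c1' where hom: "homeomorphism U1 (c1 ` U1) c1 c1'"
    using chart1 unfolding immersed_chart_def by blast
  have "openin (top_of_set X) (c2 ` W)"
    by (rule immersed_chartD(2)[OF immersed_chart_subset[OF chart2 W(1,3)]])
  moreover have "continuous_on U1 c1" "c1 \<in> U1 \<rightarrow> X"
    using hom immersed_chartD(2)[OF chart1] openin_imp_subset
    unfolding homeomorphism_def by blast+
  ultimately have "openin (top_of_set U1) (U1 \<inter> c1 -` (c2 ` W))"
    by (metis continuous_openin_preimage)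
  then have D: "open (U1 \<inter> c1 -` (c2 ` W))"
    using immersed_chartD(1)[OF chart1] openin_open_trans by blast
  show ?thesis
  proof (rule fac[OF D])
    show "u1 \<in> U1 \<inter> c1 -` c2 ` W" using u1 W(2) eq by blast
    show "(\<iota> \<circ> c1) differentiable (at u1)"
      by (rule differentiableI[OF immersed_chartD(5)[OF chart1 u1]])
    show "(\<iota> \<circ> c1) ` (U1 \<inter> c1 -` c2 ` W) \<subseteq> (\<iota> \<circ> c2) ` W" by auto
    show "(\<iota> \<circ> c2) u2 = (\<iota> \<circ> c1) u1" using eq by simp
  qed (rule W(2))
qed

definition frame_volume :: "(real^3 \<Rightarrow> complex^3) \<Rightarrow> real^3 \<Rightarrow> real" where
  "frame_volume f u = Re (hol_volume_form (tangent_map f u (axis 1 1))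
     (tangent_map f u (axis 2 1)) (tangent_map f u (axis 3 1)))"

lemma continuous_on_hol_volume_form [continuous_intros]:
  assumes "continuous_on S f" "continuous_on S g" "continuous_on S h"
  shows "continuous_on S (\<lambda>x. hol_volume_form (f x) (g x) (h x))"
  unfolding hol_volume_form_expand by (intro continuous_intros assms)

text \<open>
  On isotropic tangent planes \<open>\<Omega>\<close> of the coordinate frame is real and does not vanish. Its sign
  can be made positive at one point by reversing the chart and stays so on a neighbourhood.
\<close>

lemma positive_chart_exists:
  assumes chart: "immersed_chart X \<iota> U c" and iso: "\<And>u. u \<in> U \<Longrightarrow> special_isotropic (tangent_map (\<iota> \<circ> c) u)"
    and x: "x \<in> c ` U"
  obtains U' c' where "immersed_chart X \<iota> U' c'" "x \<in> c' ` U'"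
    "\<And>u. u \<in> U' \<Longrightarrow> frame_volume (\<iota> \<circ> c') u > 0"
proof -
  note found = that
  have positive_part: thesis
    if chart: "immersed_chart X \<iota> U c" and u: "u \<in> U" "c u = x" "frame_volume (\<iota> \<circ> c) u > 0" for U c u
  proof -
    define V where "V = {u \<in> U. frame_volume (\<iota> \<circ> c) u > 0}"
    have "continuous_on U (\<lambda>u. frame_volume (\<iota> \<circ> c) u)"
      unfolding frame_volume_def
      by (intro continuous_intros C1_continuous_on_tangent_map[OF immersed_chartD(3)[OF chart]])
    then have "open (U \<inter> frame_volume (\<iota> \<circ> c) -` {0<..})"
      by (intro continuous_open_preimage immersed_chartD(1)[OF chart]) auto
    also have "U \<inter> frame_volume (\<iota> \<circ> c) -` {0<..} = V" by (auto simp: V_def)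
    finally have "open V" .
    then have "immersed_chart X \<iota> V c"
      by (rule immersed_chart_subset[OF chart]) (auto simp: V_def)
    then show thesis
    proof (rule found)
      show "x \<in> c ` V" using u by (auto simp: V_def)
    qed (simp add: V_def)
  qed
  obtain u where u: "u \<in> U" "c u = x" using x by blast
  let ?T = "tangent_map (\<iota> \<circ> c) u"
  have "hol_volume_form (?T (axis 1 1)) (?T (axis 2 1)) (?T (axis 3 1)) \<noteq> 0"
    using iso[OF u(1)] unfolding special_isotropic_def
    by (intro hol_volume_form_nonzero_of_isotropic immersed_chartD(4,6)[OF chart u(1)]) blast
  moreover have "Im (hol_volume_form (?T (axis 1 1)) (?T (axis 2 1)) (?T (axis 3 1))) = 0"
    using iso[OF u(1)] unfolding special_isotropic_def by blast
  ultimately have "frame_volume (\<iota> \<circ> c) u \<noteq> 0"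
    by (simp add: frame_volume_def complex_eq_iff)
  then consider "frame_volume (\<iota> \<circ> c) u > 0" | "frame_volume (\<iota> \<circ> c) u < 0" by linarith
  then show thesis
  proof cases
    case 1
    then show thesis using positive_part[OF chart u] by blast
  next
    case 2
    have "(\<iota> \<circ> c) differentiable (at (- (- u)))"
      using differentiableI[OF immersed_chartD(5)[OF chart u(1)]] by simp
    from tangent_map_comp_uminus[OF this]
    have "frame_volume (\<iota> \<circ> (c \<circ> uminus)) (- u) = - frame_volume (\<iota> \<circ> c) u"
      unfolding o_assoc frame_volume_def
      by (simp add: linear_neg[OF immersed_chartD(6)[OF chart u(1)]] hol_volume_form_expand)
    then show thesis
      using positive_part[OF immersed_chart_uminus[OF chart], of "- u"] 2 u by simp
  qed
qed

text \<open>
  The orientation is the only possible one: a frame of the tangent space is positive if and only if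
  \<open>Re \<Omega>\<close> is positive on it. Positive orthonormal frames are unitary with real positive determinant,
  so their determinant is 1.
\<close>

theorem special_lagrangian_of_special_isotropic_charts:
  fixes X :: "'a::{second_countable_topology,t2_space} set"
  assumes X: "immersed_3fold X \<iota>"
    and iso: "\<And>U c u. immersed_chart X \<iota> U c \<Longrightarrow> u \<in> U \<Longrightarrow> special_isotropic (tangent_map (\<iota> \<circ> c) u)"
  shows "\<exists>ori. special_lagrangian X \<iota> ori"
proof -
  define ori :: "'a \<Rightarrow> (complex^3^3) set" where "ori x = {e. (\<exists>U c u. immersed_chart X \<iota> U c \<and> u \<in> U \<and> c u = x
      \<and> (\<forall>i. e $ i \<in> range (tangent_map (\<iota> \<circ> c) u)))
      \<and> Re (hol_volume_form (e $ 1) (e $ 2) (e $ 3)) > 0}" for x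
  have ori: "ori (c u) = cooriented_frames (coordinate_frame (\<iota> \<circ> c) u)"
    if chart: "immersed_chart X \<iota> U c" and u: "u \<in> U" and pos: "frame_volume (\<iota> \<circ> c) u > 0" for U c u
  proof -
    have "cooriented_frames (coordinate_frame (\<iota> \<circ> c) u)
      = {e. (\<forall>i. e $ i \<in> range (tangent_map (\<iota> \<circ> c) u)) \<and> Re (hol_volume_form (e $ 1) (e $ 2) (e $ 3)) > 0}"
      using iso[OF chart u] pos
      unfolding special_isotropic_def frame_volume_def
      by (intro cooriented_frames_eq[OF immersed_chartD(6)[OF chart u] coordinate_frame_def])
        (simp_all only: coordinate_frame_def vec_lambda_beta)
    also have "\<dots> = ori (c u)"
      using chart u chart_tangent_range_subset[OF _ chart _ u] unfolding ori_def by blast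
    finally show ?thesis by simp
  qed
  have "oriented_3fold X \<iota> ori"
    unfolding oriented_3fold_def
  proof
    fix x assume "x \<in> X"
    then obtain U c where c: "immersed_chart X \<iota> U c" "x \<in> c ` U"
      using X unfolding immersed_3fold_def by blast
    obtain U' c' where c': "immersed_chart X \<iota> U' c'" "x \<in> c' ` U'"
      "\<And>u. u \<in> U' \<Longrightarrow> frame_volume (\<iota> \<circ> c') u > 0"
      using positive_chart_exists[OF c(1) iso[OF c(1)] c(2)] by metis
    then have "\<forall>u\<in>U'. ori (c' u) = cooriented_frames (coordinate_frame (\<iota> \<circ> c') u)"
      using ori[OF c'(1)] by blast
    then show "\<exists>U c. immersed_chart X \<iota> U c \<and> x \<in> c ` U \<and>
        (\<forall>u\<in>U. ori (c u) = cooriented_frames (coordinate_frame (\<iota> \<circ> c) u))"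
      using c'(1,2) by blast
  qed
  moreover have "Re (hol_volume_form (e $ 1) (e $ 2) (e $ 3)) = 1"
    if "e \<in> ori x" and e: "orthonormal_frame e" for e x
  proof -
    from \<open>e \<in> ori x\<close> obtain U c u where chart: "immersed_chart X \<iota> U c" "u \<in> U"
      and "\<forall>i. e $ i \<in> range (tangent_map (\<iota> \<circ> c) u)"
      and pos: "Re (hol_volume_form (e $ 1) (e $ 2) (e $ 3)) > 0"
      unfolding ori_def by blast
    then obtain b where b: "\<And>i. e $ i = tangent_map (\<iota> \<circ> c) u (b i)"
      unfolding image_iff by metis
    have "kaehler_form (e $ i) (e $ j) = 0" for i j
      unfolding b using iso[OF chart] unfolding special_isotropic_def by blast
    then have "norm (hol_volume_form (e $ 1) (e $ 2) (e $ 3)) = 1"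
      by (rule norm_hol_volume_form_orthonormal_isotropic[OF e])
    moreover have "Im (hol_volume_form (e $ 1) (e $ 2) (e $ 3)) = 0"
      unfolding b using iso[OF chart] unfolding special_isotropic_def by blast
    ultimately show ?thesis
      using pos by (simp add: cmod_def)
  qed
  ultimately show ?thesis
    unfolding special_lagrangian_def by blast
qed

text \<open>
  The pullbacks of \<open>\<omega>\<close> and \<open>Im \<Omega>\<close> to a chart of \<open>X\<close> are continuous, and by \<open>dense_tangency\<close> they vanish
  on a dense set of points, where the tangent space of \<open>X\<close> lies in the image of a derivative of \<open>F\<close>.
\<close>

theorem special_lagrangian_in_special_isotropic_image:
  fixes X :: "'a::{second_countable_topology,t2_space} set" and F :: "real^3 \<Rightarrow> complex^3"
  assumes F: "Ck_on 1 F UNIV" and iso: "\<And>w. special_isotropic (tangent_map F w)"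
    and X: "immersed_3fold X \<iota>" and sub: "\<iota> ` X \<subseteq> range F"
  shows "\<exists>ori. special_lagrangian X \<iota> ori"
proof (rule special_lagrangian_of_special_isotropic_charts[OF X])
  fix U c u0
  assume chart: "immersed_chart X \<iota> U c" and u0: "u0 \<in> U"
  let ?f = "\<iota> \<circ> c"
  have f: "Ck_on 1 ?f U" and U: "open U"
    using immersed_chartD[OF chart] by blast+
  have range_f: "?f ` U \<subseteq> range F"
    using sub openin_imp_subset[OF immersed_chartD(2)[OF chart]] by (auto simp: image_subset_iff)
  have closed_condition: "h u0 = 0"
    if h: "continuous_on U h" and zero: "\<And>u w. u \<in> U \<Longrightarrow> range (tangent_map ?f u) \<subseteq> range (tangent_map F w) \<Longrightarrow> h u = 0"
    for h :: "real^3 \<Rightarrow> real"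
  proof (rule ccontr)
    assume "h u0 \<noteq> 0"
    define D where "D = U \<inter> h -` (- {0})"
    have "open D" unfolding D_def
      by (rule continuous_open_preimage[OF h U]) (simp add: open_Compl)
    moreover have DU: "D \<subseteq> U" by (auto simp: D_def)
    moreover have "D \<noteq> {}" using u0 \<open>h u0 \<noteq> 0\<close> by (auto simp: D_def)
    moreover have "?f ` D \<subseteq> range F" using range_f DU by blast
    moreover have "inj (tangent_map ?f u)" if "u \<in> D" for u
      using immersed_chartD(4)[OF chart] that DU by blast
    ultimately obtain u w where "u \<in> D" "range (tangent_map ?f u) \<subseteq> range (tangent_map F w)"
      using dense_tangency[OF F Ck_on_subset[OF f DU]] by metis
    then show False using zero[of u w] by (auto simp: D_def)
  qed
  have cont: "continuous_on U (\<lambda>u. tangent_map ?f u v)" for v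
    by (rule C1_continuous_on_tangent_map[OF f])
  have omega: "kaehler_form (tangent_map ?f u0 a) (tangent_map ?f u0 b) = 0" for a b
  proof (rule closed_condition)
    show "continuous_on U (\<lambda>u. kaehler_form (tangent_map ?f u a) (tangent_map ?f u b))"
      by (intro kaehler_form.continuous_on cont)
    fix u w assume "range (tangent_map ?f u) \<subseteq> range (tangent_map F w)"
    then have "\<forall>v. \<exists>v'. tangent_map ?f u v = tangent_map F w v'" by blast
    then obtain s where "\<And>v. tangent_map ?f u v = tangent_map F w (s v)" by metis
    then show "kaehler_form (tangent_map ?f u a) (tangent_map ?f u b) = 0"
      using iso[of w] unfolding special_isotropic_def by simp
  qed
  have Omega: "Im (hol_volume_form (tangent_map ?f u0 a) (tangent_map ?f u0 b) (tangent_map ?f u0 d)) = 0" for a b d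
  proof (rule closed_condition)
    show "continuous_on U (\<lambda>u. Im (hol_volume_form (tangent_map ?f u a) (tangent_map ?f u b) (tangent_map ?f u d)))"
      by (intro continuous_intros cont)
    fix u w assume "range (tangent_map ?f u) \<subseteq> range (tangent_map F w)"
    then have "\<forall>v. \<exists>v'. tangent_map ?f u v = tangent_map F w v'" by blast
    then obtain s where "\<And>v. tangent_map ?f u v = tangent_map F w (s v)" by metis
    then show "Im (hol_volume_form (tangent_map ?f u a) (tangent_map ?f u b) (tangent_map ?f u d)) = 0"
      using iso[of w] unfolding special_isotropic_def by simp
  qed
  show "special_isotropic (tangent_map ?f u0)"
    unfolding special_isotropic_def by (intro conjI allI omega Omega)
qed

lemma immersed_3fold_immersion_points:
  fixes F :: "real^3 \<Rightarrow> complex^3"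
  assumes F: "\<And>n. Ck_on n F UNIV"
  shows "immersed_3fold {w. immersion_at F w} F"
proof -
  let ?R = "{w. immersion_at F w}"
  have imm: "immersion_at F w \<longleftrightarrow> inj (tangent_map F w)" for w
    by (rule immersion_at_iff_inj[OF differentiableI[OF C1_has_derivative[OF F open_UNIV UNIV_I]]])
  have "open ?R"
  proof (rule openI)
    fix w assume "w \<in> ?R"
    then have "inj (tangent_map F w)" using imm by blast
    then obtain W where "open W" "w \<in> W" "\<And>w'. w' \<in> W \<Longrightarrow> inj (tangent_map F w')"
      by (rule C1_immersion_local_factor[OF F open_UNIV UNIV_I]) blast
    then have "open W" "w \<in> W" "W \<subseteq> ?R" using imm by auto
    then show "\<exists>e>0. ball w e \<subseteq> ?R"
      using open_contains_ball by (metis order_trans)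
  qed
  moreover have "homeomorphism ?R (id ` ?R) id id" by (simp add: homeomorphism_def)
  moreover have "smooth_on (F \<circ> id) ?R"
    unfolding smooth_on_def using Ck_on_subset[OF F] by simp
  ultimately have "immersed_chart ?R F ?R id"
    unfolding immersed_chart_def by auto
  then show ?thesis
    unfolding immersed_3fold_def by (metis id_apply image_eqI)
qed

section \<open>Smoothness of cross product polynomials\<close>

text \<open>
  Differentiability of all orders is proved by enlarging the functions \<open>p\<^sub>j(t)\<close>, \<open>q\<^sub>1(t)\<close>, \<open>q\<^sub>2(t)\<close> to a class
  of functions that contains the parametrization and that is closed under directional derivatives:
  the evolution equations express derivatives of the generators by cross products of generators.
\<close>

inductive_set ccross_polynomials :: "(real^3 \<Rightarrow> complex^3) set \<Rightarrow> (real^3 \<Rightarrow> complex^3) set"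
  for B where
  base: "b \<in> B \<Longrightarrow> b \<in> ccross_polynomials B"
| zero: "(\<lambda>w. 0) \<in> ccross_polynomials B"
| add: "f \<in> ccross_polynomials B \<Longrightarrow> g \<in> ccross_polynomials B \<Longrightarrow> (\<lambda>w. f w + g w) \<in> ccross_polynomials B"
| scale: "f \<in> ccross_polynomials B \<Longrightarrow> (\<lambda>w. r *\<^sub>R f w) \<in> ccross_polynomials B"
| coord: "f \<in> ccross_polynomials B \<Longrightarrow> (\<lambda>w. w $ i *\<^sub>R f w) \<in> ccross_polynomials B"
| cross: "f \<in> ccross_polynomials B \<Longrightarrow> g \<in> ccross_polynomials B
    \<Longrightarrow> (\<lambda>w. ccross (f w) (g w)) \<in> ccross_polynomials B"

lemma ccross_polynomials_sum:
  "(\<And>j. j \<in> A \<Longrightarrow> f j \<in> ccross_polynomials B) \<Longrightarrow> (\<lambda>w. \<Sum>j\<in>A. f j w) \<in> ccross_polynomials B"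
  by (induction A rule: infinite_finite_induct) (auto intro: ccross_polynomials.intros)

lemma ccross_polynomials_power:
  "f \<in> ccross_polynomials B \<Longrightarrow> (\<lambda>w. (w $ i) ^ n *\<^sub>R f w) \<in> ccross_polynomials B"
proof (induction n)
  case (Suc n)
  from ccross_polynomials.coord[OF Suc.IH[OF Suc.prems], of i] show ?case by simp
qed simp

lemma has_derivative_vec_nth': "((\<lambda>w. w $ i) has_derivative (\<lambda>v. v $ i)) (at w)"
  by (rule bounded_linear_imp_has_derivative[OF bounded_linear_vec_nth])

lemma ccross_polynomials_derivative:
  assumes base: "\<And>b. b \<in> B \<Longrightarrow> \<exists>b'. (\<forall>w. (b has_derivative b' w) (at w))
      \<and> (\<forall>v. (\<lambda>w. b' w v) \<in> ccross_polynomials B)"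
    and "f \<in> ccross_polynomials B"
  shows "\<exists>f'. (\<forall>w. (f has_derivative f' w) (at w)) \<and> (\<forall>v. (\<lambda>w. f' w v) \<in> ccross_polynomials B)"
  using assms(2)
proof induction
  case (base b)
  then show ?case using assms(1) by blast
next
  case zero
  show ?case
    by (intro exI[of _ "\<lambda>w v. 0"] conjI allI has_derivative_const ccross_polynomials.zero)
next
  case (add f g)
  then obtain f' g' where "\<And>w. (f has_derivative f' w) (at w)" "\<And>w. (g has_derivative g' w) (at w)"
    "\<And>v. (\<lambda>w. f' w v) \<in> ccross_polynomials B" "\<And>v. (\<lambda>w. g' w v) \<in> ccross_polynomials B"
    by blast
  then show ?case
    by (intro exI[of _ "\<lambda>w v. f' w v + g' w v"] conjI allI has_derivative_add ccross_polynomials.add)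
next
  case (scale f r)
  then obtain f' where "\<And>w. (f has_derivative f' w) (at w)" "\<And>v. (\<lambda>w. f' w v) \<in> ccross_polynomials B"
    by blast
  then show ?case
    by (intro exI[of _ "\<lambda>w v. r *\<^sub>R f' w v"] conjI allI has_derivative_scaleR_right ccross_polynomials.scale)
next
  case (coord f i)
  then obtain f' where "\<And>w. (f has_derivative f' w) (at w)" "\<And>v. (\<lambda>w. f' w v) \<in> ccross_polynomials B"
    by blast
  then show ?case using coord(1)
    by (intro exI[of _ "\<lambda>w v. w $ i *\<^sub>R f' w v + v $ i *\<^sub>R f w"] conjI allI
        has_derivative_scaleR has_derivative_vec_nth'
        ccross_polynomials.add ccross_polynomials.coord ccross_polynomials.scale)
next
  case (cross f g)
  then obtain f' g' where "\<And>w. (f has_derivative f' w) (at w)" "\<And>w. (g has_derivative g' w) (at w)"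
    "\<And>v. (\<lambda>w. f' w v) \<in> ccross_polynomials B" "\<And>v. (\<lambda>w. g' w v) \<in> ccross_polynomials B"
    by blast
  then show ?case using cross(1,2)
    by (intro exI[of _ "\<lambda>w v. ccross (f w) (g' w v) + ccross (f' w v) (g w)"] conjI allI
        ccross.FDERIV ccross_polynomials.add ccross_polynomials.cross)
qed

lemma ccross_polynomials_Ck_on:
  assumes base: "\<And>b. b \<in> B \<Longrightarrow> \<exists>b'. (\<forall>w. (b has_derivative b' w) (at w))
      \<and> (\<forall>v. (\<lambda>w. b' w v) \<in> ccross_polynomials B)"
  shows "f \<in> ccross_polynomials B \<Longrightarrow> Ck_on n f UNIV"
proof (induction n arbitrary: f)
  case 0
  then obtain f' where "\<And>w. (f has_derivative f' w) (at w)"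
    using ccross_polynomials_derivative[OF base] by blast
  then show ?case
    by (simp only: Ck_on.simps(1)) (rule has_derivative_continuous_on[of _ _ f'], simp)
next
  case (Suc n)
  then obtain f' where f': "\<And>w. (f has_derivative f' w) (at w)" "\<And>v. (\<lambda>w. f' w v) \<in> ccross_polynomials B"
    using ccross_polynomials_derivative[OF base] by blast
  have "frechet_derivative f (at w) = f' w" for w
    by (rule frechet_derivative_at[OF f'(1), symmetric])
  moreover have "f differentiable_on UNIV"
    by (simp add: differentiable_on_def) (blast intro: differentiableI f'(1))
  ultimately show ?case
    using Suc.IH[OF f'(2)] by simp
qed

section \<open>The evolution equations\<close>

text \<open>
  This shift identifies a sum over terms with \<open>p\<^bsub>j+1\<^esub>\<close> with the same sum over terms with \<open>p\<^sub>j\<close>.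
\<close>

lemma sum_atMost_shift:
  fixes g :: "nat \<Rightarrow> 'a::comm_monoid_add"
  assumes "g 0 = 0" "g (Suc k) = 0"
  shows "(\<Sum>j\<le>k. g (Suc j)) = (\<Sum>j\<le>k. g j)"
  using sum.atMost_Suc_shift[of g k] sum.atMost_Suc[of g k] assms by simp

text \<open>
  Continuing the sequence by \<open>p\<^bsub>k+1\<^esub> = 0\<close> puts the first and last evolution equations, and the
  initial condition on \<open>p\<^sub>k\<close> and \<open>q\<^sub>2\<close>, into the same form as the others.
\<close>

locale ccross_evolution =
  fixes k :: nat and P :: "nat \<Rightarrow> real \<Rightarrow> complex^3" and q1 q2 :: "real \<Rightarrow> complex^3"
  assumes beyond: "P (Suc k) = (\<lambda>t. 0)"
    and ode_P: "\<And>j t. j \<le> k \<Longrightarrow> (P j has_vector_derivative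
        (2 * (real j + 1)) *\<^sub>R ccross (P (Suc j) t) (q1 t) + (2 * real j) *\<^sub>R ccross (P j t) (q2 t)) (at t)"
    and ode_q1: "\<And>t. (q1 has_vector_derivative - (2 *\<^sub>R ccross (q1 t) (q2 t))) (at t)"
    and ode_q2: "\<And>t. (q2 has_vector_derivative 0) (at t)"
    and init_q: "kaehler_form (q1 0) (q2 0) = 0"
    and init_P: "\<And>j. j \<le> k \<Longrightarrow>
        (real j + 1) * kaehler_form (P (Suc j) 0) (q1 0) + real j * kaehler_form (P j 0) (q2 0) = 0"
begin

definition \<Phi> :: "real^3 \<Rightarrow> complex^3" where
  "\<Phi> w = evolution_map k P q1 q2 (w $ 1) (w $ 2) (w $ 3)"

definition P' :: "nat \<Rightarrow> real \<Rightarrow> complex^3" where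
  "P' j t = (2 * (real j + 1)) *\<^sub>R ccross (P (Suc j) t) (q1 t) + (2 * real j) *\<^sub>R ccross (P j t) (q2 t)"

definition \<Phi>\<^sub>x :: "real \<Rightarrow> real \<Rightarrow> real \<Rightarrow> complex^3" where
  "\<Phi>\<^sub>x x y t = (\<Sum>j\<le>k. (real j * x ^ (j - 1)) *\<^sub>R P j t) + y *\<^sub>R q2 t"

definition \<Phi>\<^sub>y :: "real \<Rightarrow> real \<Rightarrow> complex^3" where
  "\<Phi>\<^sub>y x t = q1 t + x *\<^sub>R q2 t"

text \<open>
  The evolution equations are the coefficients of \<open>\<Phi>\<^sub>t = 2 \<Phi>\<^sub>x \<times> \<Phi>\<^sub>y\<close> as a polynomial in \<open>x\<close> and \<open>y\<close>.
\<close>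

lemma t_derivative:
  "(\<Sum>j\<le>k. x ^ j *\<^sub>R P' j t) + y *\<^sub>R - (2 *\<^sub>R ccross (q1 t) (q2 t)) = 2 *\<^sub>R ccross (\<Phi>\<^sub>x x y t) (\<Phi>\<^sub>y x t)"
proof -
  have "(\<Sum>j\<le>k. x ^ j *\<^sub>R P' j t)
      = (\<Sum>j\<le>k. (2 * (real (Suc j) * x ^ (Suc j - 1))) *\<^sub>R ccross (P (Suc j) t) (q1 t))
        + (\<Sum>j\<le>k. (2 * (real j * x ^ j)) *\<^sub>R ccross (P j t) (q2 t))"
    by (simp add: P'_def scaleR_add_right sum.distrib algebra_simps)
  also have "(\<Sum>j\<le>k. (2 * (real (Suc j) * x ^ (Suc j - 1))) *\<^sub>R ccross (P (Suc j) t) (q1 t))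
      = (\<Sum>j\<le>k. (2 * (real j * x ^ (j - 1))) *\<^sub>R ccross (P j t) (q1 t))"
    by (rule sum_atMost_shift) (simp_all add: beyond ccross.zero_left kaehler_form.zero_left)
  also have "(\<Sum>j\<le>k. (2 * (real j * x ^ j)) *\<^sub>R ccross (P j t) (q2 t))
      = (\<Sum>j\<le>k. (2 * (real j * x ^ (j - 1) * x)) *\<^sub>R ccross (P j t) (q2 t))"
    by (rule sum.cong) (auto simp: power_eq_if)
  finally show ?thesis
    unfolding \<Phi>\<^sub>x_def \<Phi>\<^sub>y_def
    by (simp add: ccross.add_left ccross.add_right ccross.sum_left ccross.scaleR_left ccross.scaleR_right
        scaleR_add_right scaleR_sum_right ccross_skew[of "q2 t" "q1 t"] algebra_simps)
qed

lemma base_derivative: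
  "j \<le> k \<Longrightarrow> ((\<lambda>w. P j (w $ 3)) has_derivative (\<lambda>v. v $ 3 *\<^sub>R P' j (w $ 3))) (at (w :: real^3))"
  "((\<lambda>w. q1 (w $ 3)) has_derivative (\<lambda>v. v $ 3 *\<^sub>R - (2 *\<^sub>R ccross (q1 (w $ 3)) (q2 (w $ 3))))) (at (w :: real^3))"
  "((\<lambda>w. q2 (w $ 3)) has_derivative (\<lambda>v. 0)) (at (w :: real^3))"
proof -
  have *: "((\<lambda>w. f (w $ 3)) has_derivative (\<lambda>v. v $ 3 *\<^sub>R f')) (at w)"
    if "(f has_vector_derivative f') (at (w $ 3))" for f :: "real \<Rightarrow> complex^3" and f' and w :: "real^3"
    using has_derivative_compose[OF has_derivative_vec_nth'[of 3 w], of f] that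
    unfolding has_vector_derivative_def by blast
  show "j \<le> k \<Longrightarrow> ((\<lambda>w. P j (w $ 3)) has_derivative (\<lambda>v. v $ 3 *\<^sub>R P' j (w $ 3))) (at w)"
    unfolding P'_def by (rule *[OF ode_P])
  show "((\<lambda>w. q1 (w $ 3)) has_derivative (\<lambda>v. v $ 3 *\<^sub>R - (2 *\<^sub>R ccross (q1 (w $ 3)) (q2 (w $ 3))))) (at w)"
    by (rule *[OF ode_q1])
  show "((\<lambda>w. q2 (w $ 3)) has_derivative (\<lambda>v. 0)) (at w)"
    using *[OF ode_q2, of w] by simp
qed

lemma \<Phi>_has_derivative:
  "(\<Phi> has_derivative (\<lambda>v. v $ 1 *\<^sub>R \<Phi>\<^sub>x (w $ 1) (w $ 2) (w $ 3) + v $ 2 *\<^sub>R \<Phi>\<^sub>y (w $ 1) (w $ 3)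
     + v $ 3 *\<^sub>R (2 *\<^sub>R ccross (\<Phi>\<^sub>x (w $ 1) (w $ 2) (w $ 3)) (\<Phi>\<^sub>y (w $ 1) (w $ 3))))) (at w)"
proof -
  have "((\<lambda>w. (\<Sum>j\<le>k. (w $ 1) ^ j *\<^sub>R P j (w $ 3)) + w $ 2 *\<^sub>R q1 (w $ 3) + (w $ 1 * w $ 2) *\<^sub>R q2 (w $ 3))
    has_derivative (\<lambda>v. (\<Sum>j\<le>k. (w $ 1) ^ j *\<^sub>R (v $ 3 *\<^sub>R P' j (w $ 3))
        + (of_nat j * v $ 1 * (w $ 1) ^ (j - 1)) *\<^sub>R P j (w $ 3))
      + (w $ 2 *\<^sub>R (v $ 3 *\<^sub>R - (2 *\<^sub>R ccross (q1 (w $ 3)) (q2 (w $ 3)))) + v $ 2 *\<^sub>R q1 (w $ 3))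
      + ((w $ 1 * w $ 2) *\<^sub>R 0 + (w $ 1 * v $ 2 + v $ 1 * w $ 2) *\<^sub>R q2 (w $ 3)))) (at w)"
    by (intro has_derivative_add has_derivative_sum has_derivative_scaleR has_derivative_mult
        has_derivative_power has_derivative_vec_nth' base_derivative) simp
  then show ?thesis
    unfolding \<Phi>_def[abs_def] evolution_map_def t_derivative[symmetric]
    by (rule has_derivative_eq_rhs)
      (simp add: fun_eq_iff \<Phi>\<^sub>x_def \<Phi>\<^sub>y_def sum.distrib scaleR_add_right scaleR_sum_right algebra_simps)
qed

text \<open>
  This is the derivative of \<open>\<Phi>\<^sub>t = 2 \<Phi>\<^sub>x \<times> \<Phi>\<^sub>y\<close> in the direction of \<open>x\<close>, where the first sum
  is \<open>\<Phi>\<^bsub>xx\<^esub>\<close> and \<open>q2\<close> is \<open>\<Phi>\<^bsub>xy\<^esub>\<close>.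
\<close>

lemma x_t_derivative:
  "(\<Sum>j\<le>k. (real j * x ^ (j - 1)) *\<^sub>R P' j t)
   = 2 *\<^sub>R (ccross (\<Sum>j\<le>k. (real j * real (j - 1) * x ^ (j - 2)) *\<^sub>R P j t) (\<Phi>\<^sub>y x t)
      + ccross (\<Phi>\<^sub>x x y t) (q2 t))"
proof -
  have "(\<Sum>j\<le>k. (real j * x ^ (j - 1)) *\<^sub>R P' j t)
      = (\<Sum>j\<le>k. (2 * (real (Suc j) * real (Suc j - 1) * x ^ (Suc j - 2))) *\<^sub>R ccross (P (Suc j) t) (q1 t))
        + (\<Sum>j\<le>k. (2 * (real j * real j * x ^ (j - 1))) *\<^sub>R ccross (P j t) (q2 t))"
    by (simp add: P'_def scaleR_add_right sum.distrib algebra_simps)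
  also have "(\<Sum>j\<le>k. (2 * (real (Suc j) * real (Suc j - 1) * x ^ (Suc j - 2))) *\<^sub>R ccross (P (Suc j) t) (q1 t))
      = (\<Sum>j\<le>k. (2 * (real j * real (j - 1) * x ^ (j - 2))) *\<^sub>R ccross (P j t) (q1 t))"
    by (rule sum_atMost_shift) (simp_all add: beyond ccross.zero_left kaehler_form.zero_left)
  also have "(\<Sum>j\<le>k. (2 * (real j * real j * x ^ (j - 1))) *\<^sub>R ccross (P j t) (q2 t))
      = (\<Sum>j\<le>k. (2 * (real j * real (j - 1) * x ^ (j - 2)) * x) *\<^sub>R ccross (P j t) (q2 t))
        + (\<Sum>j\<le>k. (2 * (real j * x ^ (j - 1))) *\<^sub>R ccross (P j t) (q2 t))"
  proof -
    have "2 * (real j * real j * x ^ (j - 1))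
      = 2 * (real j * real (j - 1) * x ^ (j - 2)) * x + 2 * (real j * x ^ (j - 1))" for j
    proof (cases "j \<ge> 2")
      case True
      then obtain i where "j = Suc (Suc i)" by (metis add_2_eq_Suc le_Suc_ex)
      then show ?thesis by (simp add: algebra_simps)
    next
      case False
      then have "j = 0 \<or> j = 1" by auto
      then show ?thesis by auto
    qed
    then show ?thesis by (simp add: sum.distrib[symmetric] scaleR_add_left[symmetric])
  qed
  finally show ?thesis
    unfolding \<Phi>\<^sub>x_def \<Phi>\<^sub>y_def
    by (simp add: ccross.add_left ccross.add_right ccross.sum_left ccross.scaleR_left ccross.scaleR_right
        scaleR_add_right scaleR_sum_right algebra_simps)
qed

text \<open>
  As a polynomial in \<open>x\<close> and \<open>y\<close> the left-hand side has coefficients that vanish by the initial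
  conditions, one coefficient for each condition.
\<close>

lemma kaehler_form_initial: "kaehler_form (\<Phi>\<^sub>x x y 0) (\<Phi>\<^sub>y x 0) = 0"
proof -
  have "kaehler_form (\<Phi>\<^sub>x x y 0) (\<Phi>\<^sub>y x 0)
      = (\<Sum>j\<le>k. real j * x ^ (j - 1) * kaehler_form (P j 0) (q1 0))
        + (\<Sum>j\<le>k. real j * x ^ (j - 1) * x * kaehler_form (P j 0) (q2 0))"
    using init_q kaehler_form_skew[of "q2 0" "q1 0"] unfolding \<Phi>\<^sub>x_def \<Phi>\<^sub>y_def
    by (simp add: kaehler_form.add_left kaehler_form.add_right kaehler_form.sum_left
        kaehler_form.scaleR_left kaehler_form.scaleR_right sum_distrib_left algebra_simps)
  also have "(\<Sum>j\<le>k. real j * x ^ (j - 1) * kaehler_form (P j 0) (q1 0))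
      = (\<Sum>j\<le>k. real (Suc j) * x ^ (Suc j - 1) * kaehler_form (P (Suc j) 0) (q1 0))"
    by (rule sum_atMost_shift[symmetric]) (simp_all add: beyond ccross.zero_left kaehler_form.zero_left)
  also have "(\<Sum>j\<le>k. real j * x ^ (j - 1) * x * kaehler_form (P j 0) (q2 0))
      = (\<Sum>j\<le>k. real j * x ^ j * kaehler_form (P j 0) (q2 0))"
    by (rule sum.cong) (auto simp: power_eq_if)
  also have "(\<Sum>j\<le>k. real (Suc j) * x ^ (Suc j - 1) * kaehler_form (P (Suc j) 0) (q1 0)) + \<dots>
      = (\<Sum>j\<le>k. x ^ j * ((real j + 1) * kaehler_form (P (Suc j) 0) (q1 0) + real j * kaehler_form (P j 0) (q2 0)))"
    by (simp add: sum.distrib[symmetric] algebra_simps)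
  also have "\<dots> = 0"
    by (rule sum.neutral) (simp add: init_P)
  finally show ?thesis .
qed

text \<open>
  Write \<open>\<Phi>\<^bsub>xt\<^esub> = 2 (\<Phi>\<^bsub>xx\<^esub> \<times> \<Phi>\<^sub>y + \<Phi>\<^sub>x \<times> q\<^sub>2)\<close> and \<open>\<Phi>\<^bsub>yt\<^esub> = - 2 q\<^sub>1 \<times> q\<^sub>2\<close>. In the \<open>t\<close>-derivative of
  \<open>\<omega>(\<Phi>\<^sub>x, \<Phi>\<^sub>y)\<close> the term with \<open>\<Phi>\<^bsub>xx\<^esub>\<close> vanishes since \<open>\<Phi>\<^sub>y\<close> occurs in it twice, and the other two
  are opposite multiples of \<open>Im \<Omega>(\<Phi>\<^sub>x, q\<^sub>1, q\<^sub>2)\<close>. Thus the initial value \<open>0\<close> persists.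
\<close>

lemma kaehler_form_conserved: "kaehler_form (\<Phi>\<^sub>x x y t) (\<Phi>\<^sub>y x t) = 0"
proof -
  have "((\<lambda>t. kaehler_form (\<Phi>\<^sub>x x y t) (\<Phi>\<^sub>y x t)) has_vector_derivative 0) (at t)" for t
  proof -
    let ?U = "(\<Sum>j\<le>k. (real j * real (j - 1) * x ^ (j - 2)) *\<^sub>R P j t)"
    have dP: "(P j has_vector_derivative P' j t) (at t)" if "j \<le> k" for j
      unfolding P'_def by (rule ode_P[OF that])
    have "(\<Phi>\<^sub>x x y has_vector_derivative (\<Sum>j\<le>k. (real j * x ^ (j - 1)) *\<^sub>R P' j t) + y *\<^sub>R 0) (at t)"
      unfolding \<Phi>\<^sub>x_def[abs_def]
      by (intro has_vector_derivative_add has_vector_derivative_sum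
          bounded_linear.has_vector_derivative[OF bounded_linear_scaleR_right] dP ode_q2) simp
    then have dx: "(\<Phi>\<^sub>x x y has_vector_derivative 2 *\<^sub>R (ccross ?U (\<Phi>\<^sub>y x t) + ccross (\<Phi>\<^sub>x x y t) (q2 t))) (at t)"
      unfolding x_t_derivative[where y = y] by simp
    have "(\<Phi>\<^sub>y x has_vector_derivative - (2 *\<^sub>R ccross (q1 t) (q2 t)) + x *\<^sub>R 0) (at t)"
      unfolding \<Phi>\<^sub>y_def[abs_def]
      by (intro has_vector_derivative_add
          bounded_linear.has_vector_derivative[OF bounded_linear_scaleR_right] ode_q1 ode_q2)
    then have dy: "(\<Phi>\<^sub>y x has_vector_derivative - (2 *\<^sub>R ccross (q1 t) (q2 t))) (at t)"
      by simp
    have "kaehler_form (\<Phi>\<^sub>x x y t) (- (2 *\<^sub>R ccross (q1 t) (q2 t)))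
        + kaehler_form (2 *\<^sub>R (ccross ?U (\<Phi>\<^sub>y x t) + ccross (\<Phi>\<^sub>x x y t) (q2 t))) (\<Phi>\<^sub>y x t) = 0"
    proof -
      have "kaehler_form (\<Phi>\<^sub>x x y t) (- (2 *\<^sub>R ccross (q1 t) (q2 t)))
          = Im (hol_volume_form (\<Phi>\<^sub>x x y t) (q1 t) (q2 t))"
        by (simp add: kaehler_form.minus_right kaehler_form.scaleR_right kaehler_form_ccross)
      moreover have "kaehler_form (ccross ?U (\<Phi>\<^sub>y x t)) (\<Phi>\<^sub>y x t) = 0"
        by (subst kaehler_form_skew) simp
      moreover have "kaehler_form (ccross (\<Phi>\<^sub>x x y t) (q2 t)) (\<Phi>\<^sub>y x t)
          = 1/2 * Im (hol_volume_form (\<Phi>\<^sub>y x t) (\<Phi>\<^sub>x x y t) (q2 t))"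
        by (subst kaehler_form_skew) (simp add: kaehler_form_ccross)
      moreover have "hol_volume_form (\<Phi>\<^sub>y x t) (\<Phi>\<^sub>x x y t) (q2 t) = - hol_volume_form (\<Phi>\<^sub>x x y t) (q1 t) (q2 t)"
        unfolding \<Phi>\<^sub>y_def by (simp add: hol_volume_form_expand scaleR_conv_of_real[where 'a=complex] algebra_simps)
      ultimately show ?thesis
        by (simp add: kaehler_form.scaleR_left kaehler_form.add_left)
    qed
    then show ?thesis
      using kaehler_form.has_vector_derivative[OF dx dy] by simp
  qed
  then obtain c where "\<And>t. kaehler_form (\<Phi>\<^sub>x x y t) (\<Phi>\<^sub>y x t) = c"
    using has_vector_derivative_zero_constant[of UNIV "\<lambda>t. kaehler_form (\<Phi>\<^sub>x x y t) (\<Phi>\<^sub>y x t)"] by auto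
  then show ?thesis using kaehler_form_initial by metis
qed

lemma special_isotropic_\<Phi>: "special_isotropic (tangent_map \<Phi> w)"
proof (rule special_isotropic_of_frame)
  show "linear (tangent_map \<Phi> w)"
    unfolding frechet_derivative_at[OF \<Phi>_has_derivative, symmetric]
    by (rule has_derivative_linear[OF \<Phi>_has_derivative])
  show "tangent_map \<Phi> w (axis 1 1) = \<Phi>\<^sub>x (w $ 1) (w $ 2) (w $ 3)"
    "tangent_map \<Phi> w (axis 2 1) = \<Phi>\<^sub>y (w $ 1) (w $ 3)"
    "tangent_map \<Phi> w (axis 3 1) = 2 *\<^sub>R ccross (\<Phi>\<^sub>x (w $ 1) (w $ 2) (w $ 3)) (\<Phi>\<^sub>y (w $ 1) (w $ 3))"
    unfolding frechet_derivative_at[OF \<Phi>_has_derivative, symmetric] by (simp_all add: axis_def)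
  show "kaehler_form (\<Phi>\<^sub>x (w $ 1) (w $ 2) (w $ 3)) (\<Phi>\<^sub>y (w $ 1) (w $ 3)) = 0"
    by (rule kaehler_form_conserved)
qed

lemma Ck_on_\<Phi>: "Ck_on n \<Phi> UNIV"
proof -
  define B where "B = {\<lambda>w::real^3. P j (w $ 3) | j. j \<le> k} \<union> {\<lambda>w. q1 (w $ 3), \<lambda>w. q2 (w $ 3)}"
  have P: "(\<lambda>w. P j (w $ 3)) \<in> ccross_polynomials B" if "j \<le> Suc k" for j
  proof (cases "j = Suc k")
    case True
    then show ?thesis by (simp add: beyond ccross_polynomials.zero)
  next
    case False
    with that show ?thesis unfolding B_def by (intro ccross_polynomials.base) auto
  qed
  have q: "(\<lambda>w. q1 (w $ 3)) \<in> ccross_polynomials B" "(\<lambda>w. q2 (w $ 3)) \<in> ccross_polynomials B"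
    by (intro ccross_polynomials.base; simp add: B_def)+
  have base: "\<exists>b'. (\<forall>w. (b has_derivative b' w) (at w)) \<and> (\<forall>v. (\<lambda>w. b' w v) \<in> ccross_polynomials B)"
    if b: "b \<in> B" for b
  proof -
    from b consider j where "j \<le> k" "b = (\<lambda>w. P j (w $ 3))" | "b = (\<lambda>w. q1 (w $ 3))" | "b = (\<lambda>w. q2 (w $ 3))"
      unfolding B_def by blast
    then show ?thesis
    proof cases
      case 1
      have "(\<lambda>w. v $ 3 *\<^sub>R P' j (w $ 3)) \<in> ccross_polynomials B" for v :: "real^3"
        unfolding P'_def using 1(1)
        by (intro ccross_polynomials.scale ccross_polynomials.add ccross_polynomials.cross P q) auto
      then show ?thesis
        unfolding 1(2) using base_derivative(1)[OF 1(1)]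
        by (intro exI[of _ "\<lambda>w v. v $ 3 *\<^sub>R P' j (w $ 3)"]) blast
    next
      case 2
      have "(\<lambda>w. v $ 3 *\<^sub>R - (2 *\<^sub>R ccross (q1 (w $ 3)) (q2 (w $ 3)))) \<in> ccross_polynomials B" for v :: "real^3"
      proof -
        have "(\<lambda>w. v $ 3 *\<^sub>R ((- 2) *\<^sub>R ccross (q1 (w $ 3)) (q2 (w $ 3)))) \<in> ccross_polynomials B"
          by (intro ccross_polynomials.scale ccross_polynomials.cross q)
        then show ?thesis by simp
      qed
      then show ?thesis
        unfolding 2 using base_derivative(2)
        by (intro exI[of _ "\<lambda>w v. v $ 3 *\<^sub>R - (2 *\<^sub>R ccross (q1 (w $ 3)) (q2 (w $ 3)))"]) blast
    next
      case 3
      then show ?thesis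
        using base_derivative(3) ccross_polynomials.zero
        by (intro exI[of _ "\<lambda>w v. 0"]) blast
    qed
  qed
  have "(\<lambda>w. w $ 1 *\<^sub>R (w $ 2 *\<^sub>R q2 (w $ 3))) \<in> ccross_polynomials B"
    by (intro ccross_polynomials.coord q)
  then have mem: "\<Phi> \<in> ccross_polynomials B"
    unfolding \<Phi>_def[abs_def] evolution_map_def
    by (intro ccross_polynomials.add ccross_polynomials_sum ccross_polynomials_power
        ccross_polynomials.coord P q) auto
  show ?thesis
    by (rule ccross_polynomials_Ck_on[OF _ mem]) (rule base)
qed

end

theorem theorem12p1:
  fixes k :: nat
    and p :: "nat \<Rightarrow> real \<Rightarrow> complex^3"
    and q1 q2 :: "real \<Rightarrow> complex^3"
    and N :: "(complex^3) set"
    and \<Phi> :: "real^3 \<Rightarrow> complex^3"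
  assumes k: "k \<ge> 1"
    and init_q: "kaehler_form (q1 0) (q2 0) = 0"
    and init_pk: "kaehler_form (p k 0) (q2 0) = 0"
    and init_p: "\<And>j. 1 \<le> j \<Longrightarrow> j \<le> k \<Longrightarrow>
      real j * kaehler_form (p j 0) (q1 0)
        + (real j - 1) * kaehler_form (p (j - 1) 0) (q2 0) = 0"
    and ode_p0: "\<And>t. (p 0 has_vector_derivative 2 *\<^sub>R ccross (p 1 t) (q1 t)) (at t)"
    and ode_pk: "\<And>t. (p k has_vector_derivative
      (2 * real k) *\<^sub>R ccross (p k t) (q2 t)) (at t)"
    and ode_p: "\<And>j t. 1 \<le> j \<Longrightarrow> j \<le> k - 1 \<Longrightarrow>
      (p j has_vector_derivative
        (2 * (real j + 1)) *\<^sub>R ccross (p (j + 1) t) (q1 t)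
          + (2 * real j) *\<^sub>R ccross (p j t) (q2 t)) (at t)"
    and ode_q1: "\<And>t. (q1 has_vector_derivative - (2 *\<^sub>R ccross (q1 t) (q2 t))) (at t)"
    and ode_q2: "\<And>t. (q2 has_vector_derivative 0) (at t)"
    and N_def: "N = {evolution_map k p q1 q2 x y t | x y t. True}"
    and \<Phi>_def: "\<Phi> = (\<lambda>w. evolution_map k p q1 q2 (w $ 1) (w $ 2) (w $ 3))"
  shows "(\<exists>ori. special_lagrangian {w. immersion_at \<Phi> w} \<Phi> ori)
    \<and> (\<forall>V (X :: 'a::{second_countable_topology,t2_space} set) \<iota>.
          open V \<and> immersed_3fold X \<iota> \<and> \<iota> ` X = N \<inter> V
            \<longrightarrow> (\<exists>ori. special_lagrangian X \<iota> ori))"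
proof -
  define P where "P j = (if j \<le> k then p j else (\<lambda>t. 0))" for j
  have P: "P j = p j" if "j \<le> k" for j using that by (simp add: P_def)
  have P_beyond: "P (Suc k) = (\<lambda>t. 0)" by (simp add: P_def)
  interpret ev: ccross_evolution k P q1 q2
  proof
    fix j t assume j: "j \<le> k"
    consider "j = 0" | "j = k" "j \<noteq> 0" | "1 \<le> j" "j \<le> k - 1" using j by linarith
    then show "(P j has_vector_derivative
        (2 * (real j + 1)) *\<^sub>R ccross (P (Suc j) t) (q1 t) + (2 * real j) *\<^sub>R ccross (P j t) (q2 t)) (at t)"
    proof cases
      case 1
      then show ?thesis using ode_p0[of t] k by (simp add: P)
    next
      case 2
      then show ?thesis using ode_pk[of t] by (simp add: P P_beyond ccross.zero_left)
    next
      case 3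
      then have "Suc j \<le> k" by simp
      then show ?thesis using ode_p[OF 3, of t] j by (simp add: P)
    qed
  next
    fix j assume j: "j \<le> k"
    show "(real j + 1) * kaehler_form (P (Suc j) 0) (q1 0) + real j * kaehler_form (P j 0) (q2 0) = 0"
    proof (cases "j = k")
      case True
      then show ?thesis using init_pk by (simp add: P P_beyond kaehler_form.zero_left)
    next
      case False
      with j have "Suc j \<le> k" by simp
      then show ?thesis using init_p[of "Suc j"] j by (simp add: P algebra_simps)
    qed
  qed (fact P_beyond ode_q1 ode_q2 init_q)+
  have "evolution_map k p q1 q2 = evolution_map k P q1 q2"
    by (simp add: fun_eq_iff evolution_map_def P)
  then have \<Phi>: "\<Phi> = ev.\<Phi>"
    by (simp add: \<Phi>_def ev.\<Phi>_def[abs_def])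
  have N: "N \<subseteq> range \<Phi>"
  proof
    fix z assume "z \<in> N"
    then obtain x y t where "z = evolution_map k p q1 q2 x y t" unfolding N_def by blast
    then have "z = \<Phi> (vector [x, y, t])" by (simp add: \<Phi>_def)
    then show "z \<in> range \<Phi>" by blast
  qed
  have C1: "Ck_on 1 \<Phi> UNIV" and iso: "special_isotropic (tangent_map \<Phi> w)" for w
    unfolding \<Phi> by (rule ev.Ck_on_\<Phi>, rule ev.special_isotropic_\<Phi>)
  have "immersed_3fold {w. immersion_at \<Phi> w} \<Phi>"
    unfolding \<Phi> by (rule immersed_3fold_immersion_points[OF ev.Ck_on_\<Phi>])
  then have "\<exists>ori. special_lagrangian {w. immersion_at \<Phi> w} \<Phi> ori"
    by (rule special_lagrangian_in_special_isotropic_image[OF C1 iso]) blast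
  moreover have "\<exists>ori. special_lagrangian X \<iota> ori"
    if "immersed_3fold X \<iota>" "\<iota> ` X = N \<inter> V" for V and X :: "'a set" and \<iota>
    by (rule special_lagrangian_in_special_isotropic_image[OF C1 iso that(1)]) (use that(2) N in blast)
  ultimately show ?thesis by blast
qed

end
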